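(* Let $b\ge 3$ be an odd integer and let $G$ be a connected graph of even order $n\ge N_b=(b+1)\max\{2b+3,14\}+2$. Set $k=\left\lfloor\frac{n-2}{b+1}\right\rfloor$, for $1\le s\le k$ let $G_s=K_s\nabla\left(K_{n-(b+1)s-1}\cup(bs+1)K_1\right)$, and let $\alpha_\ast(n,b)$ be the unique $\alpha\in(\frac12,1)$ for which $\rho_\alpha(G_1)=\rho_\alpha(G_k)$. Then: 1. If $\frac12<\alpha<\alpha_\ast(n,b)$ and $\rho_\alpha(G)\ge\rho_\alpha(G_1)$, then $G$ contains an odd $[1,b]$-factor unless $G\cong G_1$. 2. If $\alpha_\ast(n,b)<\alpha<1$ and $\rho_\alpha(G)\ge\rho_\alpha(G_k)$, then $G$ contains an odd $[1,b]$-factor unless $G\cong G_k$. 3. If $\alpha=\alpha_\ast(n,b)$ and $\rho_\alpha(G)\ge\rho_\alpha(G_1)=\rho_\alpha(G_k)$, then $G$ contains an odd $[1,b]$-factor unless $G\cong G_1$ or $G\cong G_k$.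
   Context: All graphs are simple, finite and undirected. $K_m$ is the complete graph on $m$ vertices, $mK_1$ is the graph with $m$ isolated vertices, $\cup$ is the disjoint union of graphs, and $\nabla$ is the join of two graphs (disjoint union plus all edges between the two). For a graph $G$ with adjacency matrix $A(G)$ and diagonal degree matrix $D(G)$, and $\alpha\in[0,1]$, set $A_\alpha(G)=\alpha D(G)+(1-\alpha)A(G)$, and let $\rho_\alpha(G)$ be the spectral radius of $A_\alpha(G)$. For odd $b\ge1$, an odd $[1,b]$-factor of $G$ is a spanning subgraph $H$ of $G$ such that every vertex $v$ has odd degree $d_H(v)$ in $H$ with $1\le d_H(v)\le b$. Existence and uniqueness of $\alpha_\ast(n,b)$ for even $n\ge N_b$ is a separate theorem of the same paper: for every odd $b\ge3$ and even $n\ge N_b$ there is exactly one $\alpha\in(\frac12,1)$ with $\rho_\alpha(G_1)=\rho_\alpha(G_k)$. *)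

theory Defs
  imports
    "Jordan_Normal_Form.Spectral_Radius"
    "Graph_Theory.Graph_Theory"
begin

text \<open>
  A finite simple undirected graph is a \<^emph>\<open>pair_graph\<close>: an edge \<open>{u, v}\<close> is represented by the two
  arcs \<open>(u, v)\<close> and \<open>(v, u)\<close>, so the degree of a vertex is its out-degree.
\<close>

definition complete_graph :: "nat \<Rightarrow> nat pair_pre_digraph" where
  "complete_graph m = \<lparr>pverts = {..<m}, parcs = {(i, j). i < m \<and> j < m \<and> i \<noteq> j}\<rparr>"

definition isolated_vertices :: "nat \<Rightarrow> nat pair_pre_digraph" where
  "isolated_vertices m = \<lparr>pverts = {..<m}, parcs = {}\<rparr>"

definition disjoint_union ::
    "'a pair_pre_digraph \<Rightarrow> 'b pair_pre_digraph \<Rightarrow> ('a + 'b) pair_pre_digraph" where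
  "disjoint_union G H =
     \<lparr>pverts = pverts G <+> pverts H,
      parcs = map_prod Inl Inl ` parcs G \<union> map_prod Inr Inr ` parcs H\<rparr>"

definition graph_join ::
    "'a pair_pre_digraph \<Rightarrow> 'b pair_pre_digraph \<Rightarrow> ('a + 'b) pair_pre_digraph" where
  "graph_join G H =
     \<lparr>pverts = pverts (disjoint_union G H),
      parcs = parcs (disjoint_union G H)
        \<union> (Inl ` pverts G) \<times> (Inr ` pverts H) \<union> (Inr ` pverts H) \<times> (Inl ` pverts G)\<rparr>"

definition odd_factor :: "nat \<Rightarrow> 'a pair_pre_digraph \<Rightarrow> 'a pair_pre_digraph \<Rightarrow> bool" where
  "odd_factor b G H \<longleftrightarrow>
     pair_graph H \<and> spanning (with_proj H) (with_proj G) \<and>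
     (\<forall>v \<in> pverts G. odd (out_degree (with_proj H) v) \<and>
        1 \<le> out_degree (with_proj H) v \<and> out_degree (with_proj H) v \<le> b)"

text \<open>The list \<open>vs\<close> enumerates the vertices; row and column \<open>i\<close> belong to \<open>vs ! i\<close>.\<close>

definition adjacency_matrix :: "'a list \<Rightarrow> 'a pair_pre_digraph \<Rightarrow> real mat" where
  "adjacency_matrix vs G =
     mat (length vs) (length vs) (\<lambda>(i, j). if (vs ! i, vs ! j) \<in> parcs G then 1 else 0)"

definition degree_matrix :: "'a list \<Rightarrow> 'a pair_pre_digraph \<Rightarrow> real mat" where
  "degree_matrix vs G =
     mat (length vs) (length vs)
       (\<lambda>(i, j). if i = j then real (out_degree (with_proj G) (vs ! i)) else 0)"

definition A_matrix :: "real \<Rightarrow> 'a list \<Rightarrow> 'a pair_pre_digraph \<Rightarrow> real mat" where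
  "A_matrix \<alpha> vs G = \<alpha> \<cdot>\<^sub>m degree_matrix vs G + (1 - \<alpha>) \<cdot>\<^sub>m adjacency_matrix vs G"

text \<open>The choice of the enumeration is immaterial, see \<open>rho_eq\<close> below.\<close>

definition rho :: "real \<Rightarrow> 'a pair_pre_digraph \<Rightarrow> real" where
  "rho \<alpha> G =
     spectral_radius (map_mat complex_of_real
       (A_matrix \<alpha> (SOME vs. distinct vs \<and> set vs = pverts G) G))"

text \<open>
  The natural-number subtraction is exact in the relevant range
  \<open>1 \<le> s \<le> (n - 2) div (b + 1)\<close>, where \<open>(b + 1) * s + 1 < n\<close>.
\<close>

definition extremal_graph :: "nat \<Rightarrow> nat \<Rightarrow> nat \<Rightarrow> (nat + nat + nat) pair_pre_digraph" where
  "extremal_graph n b s =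
     graph_join (complete_graph s)
       (disjoint_union (complete_graph (n - (b + 1) * s - 1)) (isolated_vertices (b * s + 1)))"

definition order_bound :: "nat \<Rightarrow> nat" where
  "order_bound b = (b + 1) * max (2 * b + 3) 14 + 2"

definition k_max :: "nat \<Rightarrow> nat \<Rightarrow> nat" where
  "k_max n b = (n - 2) div (b + 1)"

definition alpha_star :: "nat \<Rightarrow> nat \<Rightarrow> real" where
  "alpha_star n b =
     (THE \<alpha>. 1 / 2 < \<alpha> \<and> \<alpha> < 1 \<and>
        rho \<alpha> (extremal_graph n b 1) = rho \<alpha> (extremal_graph n b (k_max n b)))"

lemma A_matrix_carrier: "A_matrix \<alpha> vs G \<in> carrier_mat (length vs) (length vs)"
  by (simp add: A_matrix_def degree_matrix_def adjacency_matrix_def)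

lemma eigenvalue_A_matrix_subset:
  assumes "distinct vs" "set vs = set ws" "distinct ws"
    and ev: "eigenvalue (map_mat complex_of_real (A_matrix \<alpha> vs G)) x"
  shows "eigenvalue (map_mat complex_of_real (A_matrix \<alpha> ws G)) x"
proof -
  let ?n = "length vs"
  let ?A = "map_mat complex_of_real (A_matrix \<alpha> vs G)"
  let ?B = "map_mat complex_of_real (A_matrix \<alpha> ws G)"
  have len: "length ws = ?n" using assms by (metis distinct_card)
  have dims: "dim_row ?A = ?n" "dim_col ?A = ?n" "dim_row ?B = ?n" "dim_col ?B = ?n"
    using A_matrix_carrier[of \<alpha> vs G] A_matrix_carrier[of \<alpha> ws G] len by simp_all
  from ev obtain v where "eigenvector ?A v x" unfolding eigenvalue_def by blast
  then have v: "dim_vec v = ?n" "v \<noteq> 0\<^sub>v ?n" "?A *\<^sub>v v = x \<cdot>\<^sub>v v"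
    unfolding eigenvector_def dims carrier_vec_def by blast+
  define p where "p i = (THE j. j < ?n \<and> vs ! j = ws ! i)" for i
  have ex: "\<exists>!j. j < ?n \<and> vs ! j = ws ! i" if "i < ?n" for i
    using that assms(2) len nth_mem[of i ws] by (intro distinct_Ex1[OF assms(1)]) simp
  have p: "p i < ?n" "vs ! p i = ws ! i" if "i < ?n" for i
    using theI'[OF ex[OF that]] unfolding p_def by auto
  have inj: "inj_on p {..<?n}"
  proof (rule inj_onI)
    fix i j assume "i \<in> {..<?n}" "j \<in> {..<?n}" "p i = p j"
    then show "i = j" using p(2)[of i] p(2)[of j] nth_eq_iff_index_eq[OF assms(3), of i j] len by simp
  qed
  have bij: "bij_betw p {..<?n} {..<?n}"
    unfolding bij_betw_def
    by (intro conjI inj endo_inj_surj[OF _ _ inj]) (auto simp: p(1))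
  define w where "w = vec ?n (\<lambda>i. v $ p i)"
  have ent: "?B $$ (i, j) = ?A $$ (p i, p j)" if "i < ?n" "j < ?n" for i j
    using that p len inj_onD[OF inj, of i j]
    by (auto simp: A_matrix_def degree_matrix_def adjacency_matrix_def)
  have "?B *\<^sub>v w = x \<cdot>\<^sub>v w"
  proof (rule eq_vecI)
    fix i assume "i < dim_vec (x \<cdot>\<^sub>v w)"
    then have i: "i < ?n" by (simp add: w_def)
    have "(?B *\<^sub>v w) $ i = (\<Sum>j<?n. ?B $$ (i, j) * w $ j)"
      using i len A_matrix_carrier[of \<alpha> ws G]
      by (auto simp: scalar_prod_def w_def atLeast0LessThan intro!: sum.cong)
    also have "\<dots> = (\<Sum>j<?n. ?A $$ (p i, p j) * v $ p j)"
      using i by (intro sum.cong) (auto simp: ent w_def simp del: index_map_mat)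
    also have "\<dots> = (\<Sum>j<?n. ?A $$ (p i, j) * v $ j)"
      by (rule sum.reindex_bij_betw[OF bij])
    also have "\<dots> = (?A *\<^sub>v v) $ p i"
      using p(1)[OF i] v(1) A_matrix_carrier[of \<alpha> vs G]
      by (auto simp: scalar_prod_def atLeast0LessThan intro!: sum.cong)
    also have "\<dots> = (x \<cdot>\<^sub>v w) $ i"
      using i p(1)[OF i] v by (simp add: w_def)
    finally show "(?B *\<^sub>v w) $ i = (x \<cdot>\<^sub>v w) $ i" .
  qed (use A_matrix_carrier[of \<alpha> ws G] len in \<open>simp add: w_def\<close>)
  moreover have "w \<noteq> 0\<^sub>v ?n"
  proof
    assume w0: "w = 0\<^sub>v ?n"
    have "v $ j = 0" if j: "j < ?n" for j
    proof -
      obtain i where "i < ?n" "p i = j"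
        using bij j by (metis bij_betw_imp_surj_on imageE lessThan_iff)
      then show ?thesis using w0 by (metis index_vec index_zero_vec(1) w_def)
    qed
    then have "v = 0\<^sub>v ?n" using v(1) by (intro eq_vecI) auto
    with v(2) show False ..
  qed
  ultimately show ?thesis
    unfolding eigenvalue_def eigenvector_def dims
    by (intro exI[of _ w]) (simp add: w_def)
qed

lemma rho_eq:
  assumes "distinct vs" "set vs = pverts G"
  shows "rho \<alpha> G = spectral_radius (map_mat complex_of_real (A_matrix \<alpha> vs G))"
proof -
  define ws where "ws = (SOME ws. distinct ws \<and> set ws = pverts G)"
  have ws: "distinct ws \<and> set ws = pverts G"
    unfolding ws_def by (rule someI[of _ vs]) (use assms in simp)
  have "spectrum (map_mat complex_of_real (A_matrix \<alpha> vs G)) =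
      spectrum (map_mat complex_of_real (A_matrix \<alpha> ws G))"
    using assms ws eigenvalue_A_matrix_subset[of vs ws] eigenvalue_A_matrix_subset[of ws vs]
    by (auto simp: spectrum_def)
  then show ?thesis by (simp add: rho_def spectral_radius_def ws_def)
qed

lemma pair_graph_extremal_graph: "pair_graph (extremal_graph n b s)"
proof -
  have fin: "finite {(i, j). i < m \<and> j < m \<and> i \<noteq> j}" for m :: nat
    by (rule finite_subset[of _ "{..<m} \<times> {..<m}"]) auto
  show ?thesis
    by unfold_locales
      (auto simp: extremal_graph_def graph_join_def disjoint_union_def complete_graph_def
        isolated_vertices_def symmetric_def sym_def fin)
qed

lemma card_extremal_graph:
  assumes "(b + 1) * s + 1 \<le> n"
  shows "card (pverts (extremal_graph n b s)) = n"
  using assms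
  by (simp add: extremal_graph_def graph_join_def disjoint_union_def complete_graph_def
      isolated_vertices_def card_Plus algebra_simps)

end

theory Submission
  imports Defs
begin

text \<open>
  A graph without an odd \<open>[1, b]\<close>-factor has a barrier: a set \<open>S\<close> whose removal leaves at least
  \<open>b |S| + 2\<close> components. For odd \<open>b\<close> this is Tutte's theorem for the lexicographic product of the
  graph with \<open>K\<^sub>b\<close>: in a perfect matching of the product, the edges of the graph that are used an odd
  number of times form an odd \<open>[1, b]\<close>-factor.

  Given a barrier of size \<open>s\<close>, a positive test function that is constant on each component and
  convexity in the component sizes bound \<open>\<rho>\<^sub>\<alpha>(G)\<close> by \<open>\<rho>\<^sub>\<alpha>(G\<^sub>s)\<close>, with equality only for \<open>G\<^sub>s\<close> itself.

  Put \<open>\<gamma> = 1 / (1 - \<alpha>)\<close> and \<open>\<rho>\<^sub>\<alpha>(G\<^sub>s) = n - 1 - w\<^sub>s / \<gamma>\<close>. For fixed \<open>\<gamma>\<close> and \<open>w\<close> the characteristic equation is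
  cubic in \<open>s\<close>, and its signs at a few well chosen points show that it cannot be nonpositive inside
  \<open>(1, k)\<close> while nonnegative at both ends, so \<open>\<rho>\<^sub>\<alpha>(G\<^sub>s)\<close> is maximal at \<open>s = 1\<close> or \<open>s = k\<close> only. Finally, wherever
  \<open>w\<^sub>k \<le> w\<^sub>1\<close>, the root \<open>w\<^sub>k\<close> grows with slope less than \<open>1\<close> in \<open>\<gamma>\<close>, too slowly to overtake \<open>w\<^sub>1\<close> again;
  hence the two curves cross exactly once.
\<close>

section \<open>Barriers for odd factors\<close>

text \<open>The complete graph of order n has radius n - 1, so w measures a deficit: a smaller root
  means a larger radius, and every comparison of radii is reversed when read on
  \<open>gap_root\<close>. The roots are not given in closed form; instead \<open>gap\<close> is
  strictly decreasing in w below its first pole, so comparing a root with a number, or with a root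
  for another s or \<gamma>, costs one sign evaluation of \<open>gap\<close>. The condition \<alpha>
  > 1/2 reads \<gamma> > 2. The obstacle inside (1, k) is the leading coefficient
  \<open>b * \<gamma> * (\<gamma> - 2 - b)\<close> of the cubic in s. It changes sign at \<gamma> =
  b + 2, so a negative value is needed to the right of k in one range of \<gamma> and to the left of
  1 in the other. The lower bound on n enters the numerical estimates as k \<ge> 14. The single
  crossing is also what makes \<open>alpha_star\<close> well defined; it is proved here, not
  assumed.\<close>

definition perfect_matching :: "'a set \<Rightarrow> 'a rel \<Rightarrow> ('a \<Rightarrow> 'a) \<Rightarrow> bool" where
  "perfect_matching V E f \<longleftrightarrow> (\<forall>v\<in>V. f v \<in> V \<and> f v \<noteq> v \<and> f (f v) = v \<and> (v, f v) \<in> E)"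

definition locally_constant :: "'a set \<Rightarrow> 'a rel \<Rightarrow> ('a \<Rightarrow> 'c) \<Rightarrow> bool" where
  "locally_constant W E c \<longleftrightarrow> (\<forall>u\<in>W. \<forall>v\<in>W. (u, v) \<in> E \<longrightarrow> c u = c v)"

definition odd_colours :: "'a set \<Rightarrow> ('a \<Rightarrow> 'c) \<Rightarrow> 'c set" where
  "odd_colours W c = {i. odd (card {v\<in>W. c v = i})}"

lemma odd_colours_subset: "odd_colours W c \<subseteq> c ` W"
proof
  fix i assume "i \<in> odd_colours W c"
  then have "{v\<in>W. c v = i} \<noteq> {}" unfolding odd_colours_def by (metis card.empty even_zero mem_Collect_eq)
  then show "i \<in> c ` W" by auto
qed

lemma finite_odd_colours: "finite W \<Longrightarrow> finite (odd_colours W c)"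
  using odd_colours_subset[of W c] finite_subset by blast

text \<open>Modulo 2 only the odd classes of the partition count. This makes the degrees of the
  factor odd, and it later turns more than \<open>b * card S\<close> odd classes into at least
  \<open>b * card S + 2\<close>.\<close>

lemma even_card_odd_colours:
  assumes "finite W"
  shows "even (card W + card (odd_colours W c))"
proof -
  have "card W = (\<Sum>i\<in>c ` W. card {v\<in>W. c v = i})"
    using card_UN_disjoint[of "c ` W" "\<lambda>i. {v\<in>W. c v = i}"] assms
    by (subst card_UN_disjoint[symmetric]) (auto intro: arg_cong[where f=card])
  then have "even (card W) \<longleftrightarrow> even (card {i\<in>c ` W. odd (card {v\<in>W. c v = i})})"
    using assms by (simp add: even_sum_iff)
  moreover have "{i\<in>c ` W. odd (card {v\<in>W. c v = i})} = odd_colours W c"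
    using odd_colours_subset[of W c] by (auto simp: odd_colours_def)
  ultimately show ?thesis by simp
qed

lemma even_card_fixpoint_free_involution:
  assumes "finite A" "\<And>a. a \<in> A \<Longrightarrow> f a \<in> A \<and> f a \<noteq> a \<and> f (f a) = a"
  shows "even (card A)"
  using assms
proof (induction A rule: finite_psubset_induct)
  case (psubset A)
  show ?case
  proof (cases "A = {}")
    case False
    then obtain a where a: "a \<in> A" by blast
    let ?B = "A - {a, f a}"
    have "even (card ?B)"
    proof (rule psubset.IH)
      show "?B \<subset> A" using a by blast
      fix x assume "x \<in> ?B"
      then show "f x \<in> ?B \<and> f x \<noteq> x \<and> f (f x) = x" using psubset.prems a by (metis Diff_iff empty_iff insert_iff)
    qed
    moreover have "A = insert a (insert (f a) ?B)" using a psubset.prems by auto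
    then have "card A = Suc (Suc (card ?B))"
      using psubset.hyps psubset.prems[OF a]
      by (metis (no_types, lifting) Diff_iff card_insert_disjoint finite_Diff finite_insert insert_iff)
    ultimately show ?thesis by simp
  qed simp
qed

section \<open>Perfect matchings and Tutte's theorem\<close>

lemma perfect_matching_even_clique:
  assumes "finite A" "even (card A)" "\<And>u v. u \<in> A \<Longrightarrow> v \<in> A \<Longrightarrow> u \<noteq> v \<Longrightarrow> (u, v) \<in> E"
  shows "\<exists>f. perfect_matching A E f"
  using assms
proof (induction A rule: finite_psubset_induct)
  case (psubset A)
  show ?case
  proof (cases "A = {}")
    case True
    then show ?thesis by (auto simp: perfect_matching_def)
  next
    case False
    then obtain a where a: "a \<in> A" by blast
    have "A \<noteq> {a}" using psubset.prems(1) by auto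
    then obtain b where b: "b \<in> A" "b \<noteq> a" using a by blast
    let ?B = "A - {a, b}"
    have AB: "A = insert a (insert b ?B)" using a b by auto
    then have "card A = Suc (Suc (card ?B))"
      using psubset.hyps b
      by (metis (no_types, lifting) Diff_iff card_insert_disjoint finite_Diff finite_insert insert_iff)
    then have "even (card ?B)" using psubset.prems(1) by simp
    then have "\<exists>f. perfect_matching ?B E f" using a psubset.prems(2) by (intro psubset.IH) auto
    then obtain f where f: "perfect_matching ?B E f" by blast
    have "(a, b) \<in> E" "(b, a) \<in> E" using psubset.prems(2) a b by auto
    then have "perfect_matching A E (f(a := b, b := a))"
      using f a b unfolding perfect_matching_def by auto
    then show ?thesis by blast
  qed
qed

lemma perfect_matching_by_colour:
  assumes "\<And>i. \<exists>f. perfect_matching {v\<in>W. c v = i} E f"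
  shows "\<exists>f. perfect_matching W E f"
proof -
  obtain F where F: "\<And>i. perfect_matching {v\<in>W. c v = i} E (F i)" using assms by metis
  have "perfect_matching W E (\<lambda>v. F (c v) v)"
    unfolding perfect_matching_def
  proof
    fix v assume "v \<in> W"
    then show "F (c v) v \<in> W \<and> F (c v) v \<noteq> v \<and> F (c (F (c v) v)) (F (c v) v) = v \<and> (v, F (c v) v) \<in> E"
      using F[of "c v"] by (auto simp: perfect_matching_def)
  qed
  then show ?thesis by blast
qed

text \<open>Every odd clique outside \<open>U\<close> borrows a vertex of \<open>U\<close> of its
  own, and the rest of \<open>U\<close> is a clique. All pieces are then cliques of even order and
  can be matched separately.\<close>

lemma perfect_matching_universal_cliques:
  assumes fin: "finite V" and ev: "even (card V)" and U: "U \<subseteq> V"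
    and univ: "\<And>u v. u \<in> U \<Longrightarrow> v \<in> V \<Longrightarrow> u \<noteq> v \<Longrightarrow> (u, v) \<in> E \<and> (v, u) \<in> E"
    and clique: "\<And>u v. u \<in> V - U \<Longrightarrow> v \<in> V - U \<Longrightarrow> c u = c v \<Longrightarrow> u \<noteq> v \<Longrightarrow> (u, v) \<in> E"
    and few: "card (odd_colours (V - U) c) \<le> card U"
  shows "\<exists>f. perfect_matching V E f"
proof -
  let ?O = "odd_colours (V - U) c"
  have finO: "finite ?O" using fin by (intro finite_odd_colours) auto
  have finU: "finite U" using U fin finite_subset by blast
  obtain h where h: "h ` ?O \<subseteq> U" "inj_on h ?O"
    using card_le_inj[OF finO finU few] by blast
  \<comment> \<open>\<open>Some i\<close> marks the clique of colour i with its borrowed vertex,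
    \<open>None\<close> the vertices of \<open>U\<close> that nobody borrows.\<close>
  define d where "d v = (if v \<in> V - U then Some (c v) else if v \<in> h ` ?O then Some (the_inv_into ?O h v) else None)" for v
  have cls: "{v\<in>V. d v = Some i} = {v\<in>V - U. c v = i} \<union> (if i \<in> ?O then {h i} else {})" for i
    using h U by (auto simp: d_def the_inv_into_f_f split: if_splits dest: inj_onD)
  have pmS: "\<exists>f. perfect_matching {v\<in>V. d v = Some i} E f" for i
  proof (rule perfect_matching_even_clique)
    show "finite {v\<in>V. d v = Some i}" using fin by simp
    show "even (card {v\<in>V. d v = Some i})"
    proof (cases "i \<in> ?O")
      case True
      then have "h i \<notin> {v\<in>V - U. c v = i}" using h by auto
      then have "card {v\<in>V. d v = Some i} = Suc (card {v\<in>V - U. c v = i})"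
        unfolding cls using True fin by simp
      then show ?thesis using True by (simp add: odd_colours_def)
    next
      case False
      then show ?thesis unfolding cls by (simp add: odd_colours_def)
    qed
    fix u v assume "u \<in> {v\<in>V. d v = Some i}" "v \<in> {v\<in>V. d v = Some i}" "u \<noteq> v"
    then have "u \<in> V" "v \<in> V" "u \<noteq> v" "u \<in> U \<or> v \<in> U \<or> (u \<in> V - U \<and> v \<in> V - U \<and> c u = c v)"
      by (auto simp: d_def)
    then show "(u, v) \<in> E" using univ clique by metis
  qed
  have "even (card {v\<in>V. d v \<noteq> None})"
  proof -
    obtain f where f: "perfect_matching {v\<in>V. d v \<noteq> None} E f"
    proof -
      have "\<exists>f. perfect_matching {v\<in>{v\<in>V. d v \<noteq> None}. the (d v) = i} E f" for i
      proof -
        have "{v\<in>{v\<in>V. d v \<noteq> None}. the (d v) = i} = {v\<in>V. d v = Some i}" by auto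
        then show ?thesis using pmS[of i] by simp
      qed
      from perfect_matching_by_colour[OF this] show ?thesis using that by blast
    qed
    show ?thesis
      by (rule even_card_fixpoint_free_involution[of _ f])
         (use fin f in \<open>auto simp: perfect_matching_def\<close>)
  qed
  moreover have "card V = card {v\<in>V. d v \<noteq> None} + card {v\<in>V. d v = None}"
    using fin by (subst card_Un_disjoint[symmetric]) (auto intro: arg_cong[where f=card])
  ultimately have evN: "even (card {v\<in>V. d v = None})" using ev by simp
  have "\<exists>f. perfect_matching {v\<in>V. d v = None} E f"
    by (rule perfect_matching_even_clique[OF _ evN])
       (use fin in \<open>auto simp: d_def split: if_splits intro: univ[THEN conjunct1]\<close>)
  with pmS have "\<exists>f. perfect_matching {v\<in>V. d v = i} E f" for i
    by (cases i) auto
  then show ?thesis by (rule perfect_matching_by_colour)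
qed

text \<open>
  The walk from \<open>y\<close> that takes edges of \<open>g\<close> and \<open>f\<close> alternately either avoids \<open>x\<close> and \<open>z\<close>, and then \<open>f\<close> on the
  walk and \<open>g\<close> elsewhere is a matching of \<open>E\<close>, or it can be cut at the first visit to \<open>{x, z}\<close> and closed
  by the edge from there to \<open>y\<close>.
\<close>

lemma perfect_matching_switch:
  assumes fin: "finite V" and sym: "sym E"
    and f: "perfect_matching V (E \<union> {(x, z), (z, x)}) f"
    and g: "perfect_matching V (E \<union> {(y, w), (w, y)}) g"
    and xy: "(x, y) \<in> E" "x \<noteq> y" and zy: "(z, y) \<in> E" "z \<noteq> y"
    and V: "x \<in> V" "y \<in> V" "z \<in> V" "w \<in> V"
  shows "\<exists>h. perfect_matching V E h"
proof (rule ccontr)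
  assume no: "\<not> ?thesis"
  have fI: "f v \<in> V" "f v \<noteq> v" "f (f v) = v" "(v, f v) \<in> E \<union> {(x, z), (z, x)}" if "v \<in> V" for v
    using f that by (auto simp: perfect_matching_def)
  have gI: "g v \<in> V" "g v \<noteq> v" "g (g v) = v" "(v, g v) \<in> E \<union> {(y, w), (w, y)}" if "v \<in> V" for v
    using g that by (auto simp: perfect_matching_def)
  have fx: "f x = z"
  proof (rule ccontr)
    assume "f x \<noteq> z"
    then have "perfect_matching V E f" using fI V unfolding perfect_matching_def
      by (metis Un_iff empty_iff insert_iff old.prod.inject)
    with no show False by blast
  qed
  have gy: "g y = w"
  proof (rule ccontr)
    assume "g y \<noteq> w"
    then have "perfect_matching V E g" using gI V unfolding perfect_matching_def
      by (metis Un_iff empty_iff insert_iff old.prod.inject)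
    with no show False by blast
  qed
  have fz: "f z = x" using fI(3)[OF V(1)] fx by simp
  \<comment> \<open>Even and odd positions of the walk: \<open>g\<close> leads from
    \<open>ev i\<close> to \<open>od i\<close>, and \<open>f\<close> from there to
    \<open>ev (Suc i)\<close>.\<close>
  define ev where "ev i = ((\<lambda>v. f (g v)) ^^ i) y" for i
  define od where "od i = g (ev i)" for i
  have ev0: "ev 0 = y" by (simp add: ev_def)
  have evV: "ev i \<in> V" for i by (induction i) (auto simp: ev_def V fI gI)
  have odV: "od i \<in> V" for i using evV gI by (simp add: od_def)
  have fod: "f (od i) = ev (Suc i)" for i by (simp add: od_def ev_def)
  have god: "g (od i) = ev i" for i using gI(3)[OF evV] by (simp add: od_def)
  have fev: "f (ev (Suc i)) = od i" for i using fI(3)[OF odV] fod by metis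
  have gev: "g (ev i) = od i" for i by (simp add: od_def)
  \<comment> \<open>Both kinds of step are involutions, so the walk can be traced backwards: a
    repetition among even positions forces a return to \<open>y\<close>.\<close>
  have shift: "ev (j - i) = ev 0" if "ev i = ev j" "i \<le> j" for i j
    using that
  proof (induction i arbitrary: j)
    case (Suc i)
    then obtain j' where j: "j = Suc j'" by (cases j) auto
    then have "ev i = ev j'" using Suc.prems(1) fev god by metis
    then show ?case using Suc.IH[of j'] Suc.prems j by simp
  qed simp
  \<comment> \<open>If an odd position met an even one, the stretch between them would read the same
    from both ends; shrinking it leaves a single step, that is, a fixed point of \<open>f\<close> or
    \<open>g\<close>.\<close>
  have ne': "od a \<noteq> ev b" if "b \<le> a" for a b
    using that
  proof (induction "a - b" arbitrary: a b rule: less_induct)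
    case less
    show ?case
    proof
      assume eq: "od a = ev b"
      then have eq2: "ev a = od b" using god gev by metis
      show False
      proof (cases "a = b")
        case True
        then show False using eq gI(2)[OF evV] gev by metis
      next
        case False
        then obtain a' where a': "a = Suc a'" using less.prems by (cases a) auto
        have eq3: "od a' = ev (Suc b)" using eq2 a' fev fod by metis
        show False
        proof (cases "a' = b")
          case True
          then show False using eq3 fI(2)[OF odV] fod by metis
        next
          case F: False
          then have "Suc b \<le> a'" using a' less.prems False by simp
          moreover from this have "a' - Suc b < a - b" using a' by linarith
          ultimately have "od a' \<noteq> ev (Suc b)" by (intro less.hyps)
          then show False using eq3 by contradiction
        qed
      qed
    qed
  qed
  have ne: "od a \<noteq> ev b" for a b
  proof (cases "b \<le> a")
    case False
    show ?thesis
    proof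
      assume "od a = ev b"
      then have "od b = ev a" using god gev by metis
      then show False using ne' False by (metis nat_le_linear)
    qed
  qed (use ne' in blast)
  have evx: "od i \<in> {x, z}" if "ev (Suc i) \<in> {x, z}" for i
    using that fx fz fev[of i] by auto
  show False
  proof (cases "\<exists>i. od i \<in> {x, z}")
    case False
    \<comment> \<open>The walk closes up to an alternating cycle that contains \<open>y\<close> and
      \<open>w\<close> but misses \<open>x\<close> and \<open>z\<close>.\<close>
    let ?C = "range ev \<union> range od"
    have "finite (range ev)" by (rule finite_subset[OF _ fin]) (use evV in auto)
    then have "\<not> inj ev" using finite_imageD infinite_UNIV_nat by blast
    then obtain p q where "ev p = ev q" "p \<noteq> q" by (auto simp: inj_def)
    then obtain i j where ij: "ev i = ev j" "i < j" by (metis nat_neq_iff)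
    then have "ev (j - i) = y" using shift[of i j] ev0 by simp
    then obtain N where N: "ev (Suc N) = y" using ij(2) by (metis Suc_diff_Suc)
    have evxz: "ev i \<notin> {x, z}" for i
      using False evx ev0 xy zy by (cases i) auto
    have fC: "f v \<in> ?C" if "v \<in> ?C" for v
    proof -
      have "f (ev i) \<in> range od" for i
      proof (cases i)
        case 0
        then have "f (ev i) = od N" using fev[of N] N ev0 by simp
        then show ?thesis by simp
      qed (simp add: fev)
      then show ?thesis using that fod by auto
    qed
    have gC: "g v \<in> ?C" if "v \<in> ?C" for v
      using that god gev by auto
    have xC: "x \<notin> ?C" "z \<notin> ?C" using evxz False by fastforce+
    have "y = ev 0" "w = od 0" using ev0 gev[of 0] gy by simp_all
    then have yC: "y \<in> ?C" "w \<in> ?C" by blast+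
    have "perfect_matching V E (\<lambda>v. if v \<in> ?C then f v else g v)"
      unfolding perfect_matching_def
    proof
      fix v assume v: "v \<in> V"
      show "(if v \<in> ?C then f v else g v) \<in> V \<and> (if v \<in> ?C then f v else g v) \<noteq> v \<and>
          (if (if v \<in> ?C then f v else g v) \<in> ?C then f (if v \<in> ?C then f v else g v)
            else g (if v \<in> ?C then f v else g v)) = v \<and>
          (v, if v \<in> ?C then f v else g v) \<in> E"
      proof (cases "v \<in> ?C")
        case True
        then have "v \<noteq> x" "v \<noteq> z" using xC by metis+
        then show ?thesis using fI[OF v] fC[OF True] True by simp
      next
        case F: False
        then have "v \<noteq> y" "v \<noteq> w" using yC by metis+
        moreover have "g v \<notin> ?C" using gC[of "g v"] gI(3)[OF v] F by metis
        ultimately show ?thesis using gI[OF v] F by simp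
      qed
    qed
    with no show False by blast
  next
    case True
    define i where "i = (LEAST i. od i \<in> {x, z})"
    have i: "od i \<in> {x, z}" unfolding i_def using True by (rule LeastI_ex)
    have least: "od l \<notin> {x, z}" if "l < i" for l using that not_less_Least unfolding i_def by blast
    define a where "a = od i"
    \<comment> \<open>\<open>?P\<close> is the walk up to its first visit to \<open>{x, z}\<close>,
      a union of pairs of \<open>g\<close>; \<open>?M\<close> is \<open>?P\<close> without its ends
      \<open>y\<close> and \<open>a\<close>, a union of pairs of \<open>f\<close>. Joining
      \<open>y\<close> to \<open>a\<close> leaves \<open>f\<close> inside and \<open>g\<close>
      outside.\<close>
    let ?P = "ev ` {..i} \<union> od ` {..i}"
    let ?M = "(\<lambda>l. ev (Suc l)) ` {..<i} \<union> od ` {..<i}"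
    have evS: "ev (Suc l) \<notin> {x, z}" "ev (Suc l) \<noteq> y" if "l < i" for l
    proof -
      show "ev (Suc l) \<notin> {x, z}" using evx least that by blast
      show "ev (Suc l) \<noteq> y"
      proof
        assume y: "ev (Suc l) = y"
        have "ev (Suc l + j) = ev j" for j using y ev0 by (induction j) (auto simp: ev_def)
        from this[of "i - Suc l"] have "ev i = ev (i - Suc l)" using that by simp
        then have "od (i - Suc l) = od i" by (simp add: od_def)
        then show False using least[of "i - Suc l"] i that by simp
      qed
    qed
    have Mxz: "v \<notin> {x, z}" "v \<noteq> y" if v: "v \<in> ?M" for v
    proof -
      consider l where "l < i" "v = ev (Suc l)" | l where "l < i" "v = od l"
        using v by blast
      then have "v \<notin> {x, z} \<and> v \<noteq> y"
        by cases (use evS least ne[of _ 0] ev0 in auto)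
      then show "v \<notin> {x, z}" "v \<noteq> y" by blast+
    qed
    have axz: "a \<in> {x, z}" using i a_def by simp
    have fM: "f v \<in> ?M" if v: "v \<in> ?M" for v
    proof -
      consider l where "l < i" "v = ev (Suc l)" | l where "l < i" "v = od l"
        using v by blast
      then show ?thesis by cases (auto simp: fev fod)
    qed
    have gP: "g v \<in> ?P" if "v \<in> ?P" for v
      using that god gev by auto
    have PM: "v \<in> ?P \<longleftrightarrow> v = y \<or> v = a \<or> v \<in> ?M" for v
    proof -
      have e: "{..i} = insert 0 (Suc ` {..<i})" and o: "{..i} = insert i {..<i}"
        by (auto simp flip: lessThan_Suc_atMost lessThan_Suc_eq_insert_0)
      have "ev ` {..i} = insert y ((\<lambda>l. ev (Suc l)) ` {..<i})" by (subst e) (simp add: ev0 image_image)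
      moreover have "od ` {..i} = insert a (od ` {..<i})" by (subst o) (simp add: a_def)
      ultimately show ?thesis by blast
    qed
    have "w = od 0" using gy gev[of 0] ev0 by simp
    then have wP: "w \<in> ?P" by blast
    define h where "h v = (if v = y then a else if v = a then y else if v \<in> ?M then f v else g v)" for v
    have ya: "(y, a) \<in> E" "(a, y) \<in> E" "a \<noteq> y" using axz xy zy sym by (auto dest: symD)
    have "h v \<in> V \<and> h v \<noteq> v \<and> h (h v) = v \<and> (v, h v) \<in> E" if v: "v \<in> V" for v
    proof -
      consider "v = y" | "v = a" | "v \<in> ?M" | "v \<notin> ?P" using PM by blast
      then show ?thesis
      proof cases
        case 3
        have "v \<noteq> y" "v \<noteq> a" "f v \<noteq> y" "f v \<noteq> a" using Mxz[OF 3] Mxz[OF fM[OF 3]] axz by metis+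
        then have "h v = f v" "h (f v) = f (f v)" using 3 fM[OF 3] by (auto simp: h_def)
        moreover have "v \<noteq> x" "v \<noteq> z" using Mxz[OF 3] by auto
        ultimately show ?thesis using fI[OF v] by auto
      next
        case 4
        then have g4: "g v \<notin> ?P" using gP[of "g v"] gI(3)[OF v] by metis
        have "h v = g v" "h (g v) = g (g v)" using 4 g4 PM by (auto simp: h_def)
        moreover have "v \<noteq> y" "v \<noteq> w" using 4 PM wP by metis+
        ultimately show ?thesis using gI[OF v] by auto
      qed (use ya V axz in \<open>auto simp: h_def\<close>)
    qed
    then have "perfect_matching V E h" unfolding perfect_matching_def by blast
    with no show False by blast
  qed
qed

text \<open>
  Odd components are counted through a colouring that is constant along the edges outside \<open>S\<close>; such a
  colouring survives the deletion of edges, so it is enough to treat an edge-maximal graph.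
\<close>

theorem tutte:
  assumes fin: "finite V" and E: "E \<subseteq> V \<times> V" "sym E" "irrefl E"
    and no: "\<nexists>f. perfect_matching V E f"
  shows "\<exists>S (c :: 'a \<Rightarrow> 'a set). S \<subseteq> V \<and> locally_constant (V - S) E c \<and>
    card S < card (odd_colours (V - S) c)"
proof (cases "even (card V)")
  \<comment> \<open>For odd order the empty set with a single colour is a barrier.\<close>
  case False
  have "{v\<in>V. {} = i} = (if i = {} then V else {})" for i :: "'a set" by auto
  with False have "odd_colours V (\<lambda>_. {} :: 'a set) = {{}}" by (auto simp: odd_colours_def)
  then show ?thesis by (intro exI[of _ "{}"] exI[of _ "\<lambda>_. {}"]) (auto simp: locally_constant_def)
next
  case ev: True
  define \<F> where "\<F> = {E'. E \<subseteq> E' \<and> E' \<subseteq> V \<times> V \<and> sym E' \<and> irrefl E' \<and> (\<nexists>f. perfect_matching V E' f)}"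
  have "finite \<F>" by (rule finite_subset[of _ "Pow (V \<times> V)"]) (use fin in \<open>auto simp: \<F>_def\<close>)
  moreover have "E \<in> \<F>" using E no by (simp add: \<F>_def)
  ultimately obtain M where M: "M \<in> \<F>" "\<And>B. B \<in> \<F> \<Longrightarrow> M \<subseteq> B \<Longrightarrow> B = M"
    using finite_has_maximal[of \<F>] by (metis empty_iff)
  have M': "E \<subseteq> M" "M \<subseteq> V \<times> V" "sym M" "irrefl M" "\<nexists>f. perfect_matching V M f"
    using M(1) by (auto simp: \<F>_def)
  have add: "\<exists>f. perfect_matching V (M \<union> {(p, q), (q, p)}) f"
    if "p \<in> V" "q \<in> V" "p \<noteq> q" "(p, q) \<notin> M" for p q
  proof (rule ccontr)
    assume "\<not> ?thesis"
    then have "M \<union> {(p, q), (q, p)} \<in> \<F>"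
      using M' that E unfolding \<F>_def
      by (auto simp: irrefl_def sym_def)
    then have "M \<union> {(p, q), (q, p)} = M" using M(2) by blast
    with that show False by blast
  qed
  \<comment> \<open>Lovasz's argument: adjacency is transitive through non-universal vertices, so an
    edge-maximal graph without \<open>U\<close> is a disjoint union of cliques.\<close>
  define U where "U = {u\<in>V. \<forall>v\<in>V. v \<noteq> u \<longrightarrow> (u, v) \<in> M}"
  have trans: "(x, z) \<in> M" if "(x, y) \<in> M" "(y, z) \<in> M" "x \<noteq> z" "y \<in> V - U" for x y z
  proof (rule ccontr)
    assume xz: "(x, z) \<notin> M"
    obtain w where w: "w \<in> V" "w \<noteq> y" "(y, w) \<notin> M" using \<open>y \<in> V - U\<close> by (auto simp: U_def)
    have xV: "x \<in> V" "y \<in> V" "z \<in> V" using that M' by auto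
    obtain f where "perfect_matching V (M \<union> {(x, z), (z, x)}) f"
      using add[OF xV(1,3) \<open>x \<noteq> z\<close> xz] by blast
    moreover obtain g where "perfect_matching V (M \<union> {(y, w), (w, y)}) g"
      using add[OF xV(2) w(1) w(2)[symmetric] w(3)] by blast
    moreover have "x \<noteq> y" "z \<noteq> y" using that M'(4) by (auto simp: irrefl_def)
    moreover have "(z, y) \<in> M" using that M'(3) by (auto dest: symD)
    ultimately have "\<exists>h. perfect_matching V M h"
      by (intro perfect_matching_switch[OF fin M'(3), of x z f y w g] that xV w)
    with M' show False by blast
  qed
  \<comment> \<open>Closed neighbourhoods outside \<open>U\<close> name the cliques, which is why
    colours are sets of vertices.\<close>
  define c where "c v = {u\<in>V - U. u = v \<or> (v, u) \<in> M}" for v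
  have lc: "locally_constant (V - U) M c"
    unfolding locally_constant_def
  proof (intro ballI impI)
    fix u v assume uv: "u \<in> V - U" "v \<in> V - U" "(u, v) \<in> M"
    then have vu: "(v, u) \<in> M" using M'(3) by (auto dest: symD)
    show "c u = c v"
      using trans[OF uv(3) _ _ uv(2)] trans[OF vu _ _ uv(1)] uv vu by (auto simp: c_def)
  qed
  have "\<not> card (odd_colours (V - U) c) \<le> card U"
  proof
    assume few: "card (odd_colours (V - U) c) \<le> card U"
    have "\<exists>f. perfect_matching V M f"
    proof (rule perfect_matching_universal_cliques[OF fin ev _ _ _ few])
      fix u v assume "u \<in> V - U" "v \<in> V - U" "c u = c v" "u \<noteq> v"
      then show "(u, v) \<in> M" by (auto simp: c_def)
    qed (use M'(3) in \<open>auto simp: U_def dest: symD\<close>)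
    with M' show False by blast
  qed
  moreover have "locally_constant (V - U) E c" using lc M'(1) by (auto simp: locally_constant_def)
  ultimately show ?thesis by (intro exI[of _ U] exI[of _ c]) (auto simp: U_def)
qed

text \<open>Only vertices with all \<open>b\<close> copies in \<open>S'\<close> enter
  \<open>S\<close>; each remaining element of \<open>S'\<close> can spoil at most one colour. The
  surviving copies of a vertex are pairwise adjacent and share a colour, so an unspoiled class
  consists of \<open>b\<close> copies of a class of the original graph, and as \<open>b\<close> is
  odd both have the same parity.\<close>

lemma lexicographic_barrier:
  fixes V :: "'a set" and c' :: "'a \<times> nat \<Rightarrow> 'c"
  assumes fin: "finite V" and b: "odd b"
    and S': "S' \<subseteq> V \<times> {..<b}"
    and lc: "locally_constant (V \<times> {..<b} - S')
      {((u, i), (v, j)). (u, v) \<in> E \<or> u = v \<and> i \<noteq> j} c'"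
    and many: "card S' < card (odd_colours (V \<times> {..<b} - S') c')"
  shows "\<exists>S (c :: 'a \<Rightarrow> 'c). S \<subseteq> V \<and> locally_constant (V - S) E c \<and> b * card S < card (odd_colours (V - S) c)"
proof -
  define S where "S = {v\<in>V. \<forall>j<b. (v, j) \<in> S'}"
  define c where "c v = c' (v, SOME j. j < b \<and> (v, j) \<notin> S')" for v
  have pick: "\<exists>j<b. (v, j) \<notin> S' \<and> c v = c' (v, j)" if "v \<in> V - S" for v
  proof -
    have "\<exists>j. j < b \<and> (v, j) \<notin> S'" using that by (auto simp: S_def)
    from someI_ex[OF this] show ?thesis unfolding c_def by blast
  qed
  have c': "c' (v, j) = c v" if "v \<in> V" "j < b" "(v, j) \<notin> S'" for v j
  proof -
    have "v \<in> V - S" using that by (auto simp: S_def)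
    then obtain i where i: "i < b" "(v, i) \<notin> S'" "c v = c' (v, i)" using pick by blast
    show ?thesis
    proof (cases "i = j")
      case False
      then show ?thesis using lc i that unfolding locally_constant_def by fastforce
    qed (use i in simp)
  qed
  have SV: "S \<subseteq> V" by (auto simp: S_def)
  have finS: "finite S" using SV fin finite_subset by blast
  have finS': "finite S'" using S' fin by (meson finite_SigmaI finite_lessThan finite_subset)
  have SS': "S \<times> {..<b} \<subseteq> S'" by (auto simp: S_def)
  define R where "R = S' - S \<times> {..<b}"
  have cardR: "card S' = b * card S + card R"
    unfolding R_def using card_Diff_subset[OF _ SS'] card_mono[OF finS' SS'] finS
    by (simp add: card_cartesian_product mult.commute)
  have RV: "fst p \<in> V - S" "snd p < b" if "p \<in> R" for p
    using that S' by (auto simp: R_def)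
  have "odd_colours (V \<times> {..<b} - S') c' \<subseteq> odd_colours (V - S) c \<union> (c \<circ> fst) ` R"
  proof
    fix i assume i: "i \<in> odd_colours (V \<times> {..<b} - S') c'"
    show "i \<in> odd_colours (V - S) c \<union> (c \<circ> fst) ` R"
    proof (cases "i \<in> (c \<circ> fst) ` R")
      case False
      have "{p \<in> V \<times> {..<b} - S'. c' p = i} = {v\<in>V - S. c v = i} \<times> {..<b}"
      proof (intro subset_antisym subsetI)
        fix p assume "p \<in> {p \<in> V \<times> {..<b} - S'. c' p = i}"
        then show "p \<in> {v\<in>V - S. c v = i} \<times> {..<b}" using c' by (cases p) (auto simp: S_def)
      next
        fix p assume p: "p \<in> {v\<in>V - S. c v = i} \<times> {..<b}"
        have "p \<notin> S'"
        proof
          assume "p \<in> S'"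
          then have "p \<in> R" using p by (auto simp: R_def)
          moreover have "(c \<circ> fst) p = i" using p by auto
          ultimately show False using False by blast
        qed
        then show "p \<in> {p \<in> V \<times> {..<b} - S'. c' p = i}" using p c' by (cases p) auto
      qed
      then have "odd (card {v\<in>V - S. c v = i} * b)"
        using i by (simp add: odd_colours_def card_cartesian_product)
      then show ?thesis by (simp add: odd_colours_def)
    qed simp
  qed
  then have "card (odd_colours (V \<times> {..<b} - S') c') \<le> card (odd_colours (V - S) c \<union> (c \<circ> fst) ` R)"
    using fin finS' by (intro card_mono) (auto simp: R_def intro: finite_odd_colours)
  also have "\<dots> \<le> card (odd_colours (V - S) c) + card R"
    using finS' card_image_le[of R "c \<circ> fst"] by (intro order.trans[OF card_Un_le]) (simp add: R_def)
  finally have "b * card S < card (odd_colours (V - S) c)" using many cardR by simp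
  moreover have "locally_constant (V - S) E c"
    unfolding locally_constant_def
  proof (intro ballI impI)
    fix u v assume uv: "u \<in> V - S" "v \<in> V - S" "(u, v) \<in> E"
    obtain i j where "i < b" "(u, i) \<notin> S'" "c u = c' (u, i)" "j < b" "(v, j) \<notin> S'" "c v = c' (v, j)"
      using pick uv by meson
    then show "c u = c v" using lc uv unfolding locally_constant_def by fastforce
  qed
  ultimately show ?thesis using SV by blast
qed

text \<open>Let \<open>m u v\<close> count the copies of \<open>u\<close> matched to copies of
  \<open>v\<close>. For fixed \<open>u\<close> these numbers add up to \<open>b\<close>, and the one
  for \<open>v = u\<close> is even because the matching pairs those copies off. Hence an odd number
  of neighbours, at most \<open>b\<close>, have odd \<open>m u v\<close>.\<close>

lemma perfect_matching_imp_odd_factor: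
  assumes G: "pair_graph G" and b: "odd b"
    and f: "perfect_matching (pverts G \<times> {..<b}) {((u, i), (v, j)). (u, v) \<in> parcs G \<or> u = v \<and> i \<noteq> j} f"
  shows "\<exists>H. odd_factor b G H"
proof -
  interpret pair_graph G by (rule G)
  let ?V = "pverts G"
  define m where "m u v = card {i\<in>{..<b}. fst (f (u, i)) = v}" for u v
  have fI: "fst (f (u, i)) \<in> ?V" "snd (f (u, i)) < b" "f (u, i) \<noteq> (u, i)" "f (f (u, i)) = (u, i)"
    "(u, fst (f (u, i))) \<in> parcs G \<or> u = fst (f (u, i))" if "u \<in> ?V" "i < b" for u i
  proof -
    have "(u, i) \<in> ?V \<times> {..<b}" using that by simp
    with f have *: "f (u, i) \<in> ?V \<times> {..<b} \<and> f (u, i) \<noteq> (u, i) \<and> f (f (u, i)) = (u, i) \<and>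
        ((u, i), f (u, i)) \<in> {((u, i), (v, j)). (u, v) \<in> parcs G \<or> u = v \<and> i \<noteq> j}"
      unfolding perfect_matching_def by (rule bspec)
    then show "fst (f (u, i)) \<in> ?V" "snd (f (u, i)) < b" "f (u, i) \<noteq> (u, i)" "f (f (u, i)) = (u, i)"
      by (auto simp: mem_Times_iff)
    show "(u, fst (f (u, i))) \<in> parcs G \<or> u = fst (f (u, i))"
      using * by (auto simp: case_prod_beta)
  qed
  have m_sym: "m u v = m v u" if "u \<in> ?V" "v \<in> ?V" for u v
    unfolding m_def
  proof (rule bij_betw_same_card[OF bij_betw_byWitness])
    have *: "snd (f (v, snd (f (u, i)))) = i \<and> snd (f (u, i)) \<in> {i\<in>{..<b}. fst (f (v, i)) = u}"
      if "u \<in> ?V" "i \<in> {i\<in>{..<b}. fst (f (u, i)) = v}" for u v i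
    proof -
      have "f (u, i) = (v, snd (f (u, i)))" using that(2) by (metis (mono_tags, lifting) mem_Collect_eq prod.collapse)
      then have "f (v, snd (f (u, i))) = (u, i)" using fI(4)[of u i] that by simp
      then show ?thesis using fI(2)[of u i] that by simp
    qed
    show "\<forall>i\<in>{i\<in>{..<b}. fst (f (u, i)) = v}. snd (f (v, snd (f (u, i)))) = i"
      "\<forall>i\<in>{i\<in>{..<b}. fst (f (v, i)) = u}. snd (f (u, snd (f (v, i)))) = i"
      "(\<lambda>i. snd (f (u, i))) ` {i\<in>{..<b}. fst (f (u, i)) = v} \<subseteq> {i\<in>{..<b}. fst (f (v, i)) = u}"
      "(\<lambda>i. snd (f (v, i))) ` {i\<in>{..<b}. fst (f (v, i)) = u} \<subseteq> {i\<in>{..<b}. fst (f (u, i)) = v}"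
      using *[OF that(1)] *[OF that(2)] by blast+
  qed
  have m_diag: "even (m u u)" if u: "u \<in> ?V" for u
    unfolding m_def
  proof (rule even_card_fixpoint_free_involution[where f="\<lambda>i. snd (f (u, i))"])
    fix i assume i: "i \<in> {i\<in>{..<b}. fst (f (u, i)) = u}"
    then have *: "f (u, i) = (u, snd (f (u, i)))" by (metis (mono_tags, lifting) mem_Collect_eq prod.collapse)
    then have "f (u, snd (f (u, i))) = (u, i)" using fI(4)[OF u, of i] i by simp
    moreover have "snd (f (u, i)) \<noteq> i" using fI(3)[OF u, of i] i * by auto
    ultimately show "snd (f (u, i)) \<in> {i\<in>{..<b}. fst (f (u, i)) = u} \<and> snd (f (u, i)) \<noteq> i \<and> snd (f (u, snd (f (u, i)))) = i"
      using fI(2)[OF u, of i] i by simp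
  qed simp
  define H where "H = \<lparr>pverts = ?V, parcs = {(u, v). u \<in> ?V \<and> v \<in> ?V \<and> u \<noteq> v \<and> odd (m u v)}\<rparr>"
  have HG: "parcs H \<subseteq> parcs G"
  proof
    fix e assume "e \<in> parcs H"
    then obtain u v where e: "e = (u, v)" "u \<in> ?V" "v \<in> ?V" "u \<noteq> v" "odd (m u v)" by (auto simp: H_def)
    then have "{i\<in>{..<b}. fst (f (u, i)) = v} \<noteq> {}" unfolding m_def by (metis card.empty even_zero)
    then obtain i where "i < b" "fst (f (u, i)) = v" by auto
    then show "e \<in> parcs G" using fI(5)[of u i] e by auto
  qed
  have "pair_graph H"
  proof
    show "finite (pverts H)" using pair_finite_verts by (simp add: H_def)
    show "finite (parcs H)" using HG pair_finite_arcs finite_subset by blast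
    show "symmetric (with_proj H)" using m_sym by (auto simp: symmetric_def H_def sym_def)
  qed (auto simp: H_def)
  moreover from this have "pair_wf_digraph H" by (simp add: pair_graph_def pair_digraph_def pair_fin_digraph_def)
  then have "wf_digraph (with_proj H)" by (simp add: wf_digraph_wp_iff)
  then have "spanning (with_proj H) (with_proj G)"
    unfolding spanning_def subgraph_def
    using HG wf_digraph_axioms by (simp add: H_def compatible_def)
  moreover have "odd (out_degree (with_proj H) u) \<and> 1 \<le> out_degree (with_proj H) u \<and> out_degree (with_proj H) u \<le> b"
    if u: "u \<in> ?V" for u
  proof -
    let ?O = "odd_colours {..<b} (\<lambda>i. fst (f (u, i)))"
    have mem: "v \<in> ?O \<longleftrightarrow> odd (m u v)" for v by (simp add: odd_colours_def m_def)
    have "?O \<subseteq> ?V" using odd_colours_subset[of "{..<b}" "\<lambda>i. fst (f (u, i))"] fI(1)[OF u] by auto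
    then have "out_arcs (with_proj H) u = Pair u ` ?O"
      using m_diag[OF u] u mem by (auto simp: out_arcs_def H_def)
    then have "out_degree (with_proj H) u = card ?O"
      by (simp add: out_degree_def card_image inj_on_def)
    moreover have "odd (card ?O)" using even_card_odd_colours[of "{..<b}" "\<lambda>i. fst (f (u, i))"] b by simp
    moreover have "card ?O \<le> b"
      using card_mono[OF _ odd_colours_subset[of "{..<b}" "\<lambda>i. fst (f (u, i))"]]
        card_image_le[of "{..<b}" "\<lambda>i. fst (f (u, i))"] by simp
    ultimately show ?thesis using odd_pos by (metis One_nat_def Suc_leI)
  qed
  ultimately have "odd_factor b G H" unfolding odd_factor_def by (auto simp: H_def)
  then show ?thesis ..
qed

lemma perfect_matching_mono: "perfect_matching V E f \<Longrightarrow> E \<subseteq> E' \<Longrightarrow> perfect_matching V E' f"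
  by (auto simp: perfect_matching_def)

lemma locally_constant_Int: "locally_constant W (E \<inter> V \<times> V) c \<Longrightarrow> W \<subseteq> V \<Longrightarrow> locally_constant W E c"
  by (auto simp: locally_constant_def)

text \<open>Parity gains one class: for even order and odd \<open>b\<close> the number of odd
  classes has the parity of \<open>b * card S\<close>, so exceeding it means exceeding it by two.
  All classes other than \<open>b * card S + 1\<close> chosen odd ones are merged into one last
  colour, which fixes the number of colours.\<close>

theorem odd_factor_or_barrier:
  assumes G: "pair_graph G" and b: "odd b" and ev: "even (card (pverts G))"
    and no: "\<nexists>H. odd_factor b G H"
  shows "\<exists>S (c :: 'a \<Rightarrow> nat). S \<subseteq> pverts G \<and> locally_constant (pverts G - S) (parcs G) c \<and>
    c ` (pverts G - S) = {..b * card S + 1}"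
proof -
  interpret pair_graph G by (rule G)
  let ?V = "pverts G"
  define W where "W = ?V \<times> {..<b}"
  define L where "L = {((u, i), (v, j)). (u, v) \<in> parcs G \<or> u = v \<and> i \<noteq> (j :: nat)}"
  have "\<nexists>f. perfect_matching W (L \<inter> W \<times> W) f"
  proof
    assume "\<exists>f. perfect_matching W (L \<inter> W \<times> W) f"
    then obtain f where "perfect_matching W (L \<inter> W \<times> W) f" ..
    then have "perfect_matching W L f" by (rule perfect_matching_mono) blast
    with no show False using perfect_matching_imp_odd_factor[OF G b] unfolding W_def L_def by blast
  qed
  moreover have "finite W" using pair_finite_verts by (simp add: W_def)
  moreover have "L \<inter> W \<times> W \<subseteq> W \<times> W" by blast
  moreover have "sym (L \<inter> W \<times> W)" using arcs_symmetric by (auto simp: sym_def L_def)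
  moreover have "irrefl (L \<inter> W \<times> W)" using no_loops' by (auto simp: irrefl_def L_def)
  ultimately obtain S' and c' :: "'a \<times> nat \<Rightarrow> ('a \<times> nat) set" where S': "S' \<subseteq> W"
      "locally_constant (W - S') (L \<inter> W \<times> W) c'" "card S' < card (odd_colours (W - S') c')"
    using tutte[of W "L \<inter> W \<times> W"] by blast
  have "locally_constant (W - S') L c'" by (rule locally_constant_Int[OF S'(2)]) blast
  from lexicographic_barrier[OF pair_finite_verts b S'(1)[unfolded W_def] this[unfolded W_def L_def]
      S'(3)[unfolded W_def]]
  obtain S and c :: "'a \<Rightarrow> ('a \<times> nat) set" where S: "S \<subseteq> ?V" "locally_constant (?V - S) (parcs G) c"
      "b * card S < card (odd_colours (?V - S) c)"
    by blast
  let ?O = "odd_colours (?V - S) c"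
  have finS: "finite S" using S pair_finite_verts finite_subset by blast
  have "even (card (?V - S) + card ?O)" using pair_finite_verts by (intro even_card_odd_colours) simp
  then have "even (b * card S) \<longleftrightarrow> even (card ?O)"
    using b ev card_Diff_subset[OF finS S(1)] card_mono[OF pair_finite_verts S(1)] by auto
  then have "card ?O \<noteq> b * card S + 1" by auto
  then have O: "b * card S + 2 \<le> card ?O" using S(3) by simp
  then obtain Q where Q: "Q \<subseteq> ?O" "card Q = b * card S + 1"
    using obtain_subset_with_card_n[of "b * card S + 1" ?O] by auto
  have finO: "finite ?O" using pair_finite_verts by (intro finite_odd_colours) simp
  have finQ: "finite Q" using Q finO finite_subset by blast
  obtain e where e: "bij_betw e Q {..<b * card S + 1}"
    using ex_bij_betw_finite_nat[OF finQ] Q(2) by (auto simp: atLeast0LessThan)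
  define d where "d v = (if c v \<in> Q then e (c v) else b * card S + 1)" for v
  have Oc: "?O \<subseteq> c ` (?V - S)" by (rule odd_colours_subset)
  have "d ` (?V - S) = {..b * card S + 1}"
  proof (intro subset_antisym subsetI)
    fix i assume "i \<in> d ` (?V - S)"
    then show "i \<in> {..b * card S + 1}" using bij_betwE[OF e] by (auto simp: d_def less_imp_le)
  next
    fix i assume i: "i \<in> {..b * card S + 1}"
    show "i \<in> d ` (?V - S)"
    proof (cases "i = b * card S + 1")
      case True
      have "\<not> ?O \<subseteq> Q" using card_mono[OF finQ] O Q by fastforce
      then obtain v where "v \<in> ?V - S" "c v \<notin> Q" using Oc by blast
      then show ?thesis using True by (auto simp: d_def image_iff)
    next
      case False
      then have "i \<in> e ` Q" using i e by (auto simp: bij_betw_def)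
      then obtain v where "v \<in> ?V - S" "c v \<in> Q" "i = e (c v)" using Oc Q by blast
      then show ?thesis by (auto simp: d_def image_iff)
    qed
  qed
  moreover have "locally_constant (?V - S) (parcs G) d"
    using S(2) by (simp add: locally_constant_def d_def)
  ultimately show ?thesis using S(1) by blast
qed

section \<open>The characteristic equation of the extremal graphs\<close>

text \<open>
  The quotient matrix of \<open>G\<^sub>s\<close> has the eigenvalue \<open>n - 1 - w / \<gamma>\<close>, for \<open>\<alpha> = 1 - 1 / \<gamma>\<close>, iff
  \<open>gap n b s \<gamma> w = 0\<close>; the spectral radius belongs to the root below the first pole.
\<close>

definition gap :: "real \<Rightarrow> real \<Rightarrow> real \<Rightarrow> real \<Rightarrow> real \<Rightarrow> real" where
  "gap n b s \<gamma> w = n - s - w -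
     s * ((n - 1 - (b + 1) * s) / ((b * s + 1) * \<gamma> + s - w) + (b * s + 1) / ((n - 1 - s) * \<gamma> + s - w))"

definition admissible :: "real \<Rightarrow> real \<Rightarrow> real \<Rightarrow> real \<Rightarrow> bool" where
  "admissible n b s \<gamma> \<longleftrightarrow> 1 \<le> s \<and> 0 \<le> b \<and> (b + 1) * s + 2 \<le> n \<and> 1 < \<gamma>"

definition gap_root :: "real \<Rightarrow> real \<Rightarrow> real \<Rightarrow> real \<Rightarrow> real" where
  "gap_root n b s \<gamma> = (THE w. w < (b * s + 1) * \<gamma> + s \<and> gap n b s \<gamma> w = 0)"

lemma admissibleD:
  assumes "admissible n b s \<gamma>"
  shows "1 \<le> s" "0 \<le> b" "1 \<le> n - 1 - (b + 1) * s" "1 < \<gamma>" "1 \<le> b * s + 1" "b * s + 1 \<le> n - 1 - s"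
  using assms by (auto simp: admissible_def algebra_simps)

lemma admissible_denominators:
  assumes "admissible n b s \<gamma>"
  shows "(b * s + 1) * \<gamma> + s - w \<le> (n - 1 - s) * \<gamma> + s - w"
  using admissibleD[OF assms] by (simp add: mult_right_mono)

lemma admissible_mono:
  assumes "admissible n b k \<gamma>" "1 \<le> s" "s \<le> k"
  shows "admissible n b s \<gamma>"
proof -
  have "(b + 1) * s \<le> (b + 1) * k" using assms by (intro mult_left_mono) (auto simp: admissible_def)
  then have "(b + 1) * s + 2 \<le> n" using assms unfolding admissible_def by linarith
  then show ?thesis using assms by (simp add: admissible_def)
qed

lemma gap_strict_antimono:
  assumes "admissible n b s \<gamma>" "w < w'" "w' < (b * s + 1) * \<gamma> + s"
  shows "gap n b s \<gamma> w' < gap n b s \<gamma> w"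
proof -
  note a = admissibleD[OF assms(1)] and d = admissible_denominators[OF assms(1)]
  have "0 < (b * s + 1) * \<gamma> + s - w'" "(b * s + 1) * \<gamma> + s - w' < (b * s + 1) * \<gamma> + s - w"
    "(n - 1 - s) * \<gamma> + s - w' < (n - 1 - s) * \<gamma> + s - w" using assms by auto
  note p = this order.strict_trans2[OF this(1) d]
  have "(n - 1 - (b + 1) * s) / ((b * s + 1) * \<gamma> + s - w) \<le> (n - 1 - (b + 1) * s) / ((b * s + 1) * \<gamma> + s - w')"
    using a(3) p by (intro divide_left_mono mult_pos_pos) linarith+
  moreover have "(b * s + 1) / ((n - 1 - s) * \<gamma> + s - w) \<le> (b * s + 1) / ((n - 1 - s) * \<gamma> + s - w')"
    using a(5) p by (intro divide_left_mono mult_pos_pos) linarith+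
  ultimately have "s * ((n - 1 - (b + 1) * s) / ((b * s + 1) * \<gamma> + s - w) + (b * s + 1) / ((n - 1 - s) * \<gamma> + s - w)) \<le>
      s * ((n - 1 - (b + 1) * s) / ((b * s + 1) * \<gamma> + s - w') + (b * s + 1) / ((n - 1 - s) * \<gamma> + s - w'))"
    using a(1) by (intro mult_left_mono add_mono) auto
  then show ?thesis using assms by (simp add: gap_def)
qed

lemma gap_root_ex:
  assumes "admissible n b s \<gamma>"
  shows "\<exists>w\<ge>0. w < (b * s + 1) * \<gamma> + s \<and> gap n b s \<gamma> w = 0"
proof -
  note a = admissibleD[OF assms]
  define m t B where "m = n - 1 - (b + 1) * s" and "t = b * s + 1" and "B = (b * s + 1) * \<gamma> + s"
  have nmt: "n = s + m + t" by (simp add: m_def t_def algebra_simps)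
  have mt: "1 \<le> m" "1 \<le> t" using a by (auto simp: m_def t_def)
  have B: "B = t * \<gamma> + s" by (simp add: B_def t_def)
  have tg: "t \<le> t * \<gamma>" "0 \<le> m * \<gamma>" "0 < t * \<gamma>" using mt a by auto
  have n0: "0 < n" using nmt mt a by linarith
  \<comment> \<open>Chosen so that the first fraction times s equals n, which makes
    \<open>gap\<close> nonpositive there.\<close>
  define w1 where "w1 = B - s * m / n"
  have "s * m \<le> s * n" using a mt nmt by (intro mult_left_mono) linarith+
  then have sm: "0 < s * m / n" "s * m / n \<le> s" using n0 mt(1) a(1) by (simp_all add: divide_le_eq)
  have w1: "0 \<le> w1" "w1 < B" using sm tg B by (auto simp: w1_def)
  have Q: "(n - 1 - s) * \<gamma> + s - w \<ge> B - w" for w using admissible_denominators[OF assms] by (simp add: B_def)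
  have "gap n b s \<gamma> 0 \<ge> 0"
  proof -
    have aux: "s * (x / y) \<le> x" if "0 < y" "s \<le> y" "1 \<le> x" for x y :: real
      using mult_left_mono[of s y x] that by (simp add: divide_le_eq mult.commute)
    have sB: "0 < B" "s \<le> B" using a(1) B tg by linarith+
    have "s * (m / B) \<le> m" using sB mt(1) by (rule aux)
    moreover have "s * (t / ((n - 1 - s) * \<gamma> + s)) \<le> t"
      using sB Q[of 0] mt(2) by (intro aux) linarith+
    ultimately have "s * (m / B + t / ((n - 1 - s) * \<gamma> + s)) \<le> m + t" by (simp add: distrib_left)
    moreover have "gap n b s \<gamma> 0 = n - s - s * (m / B + t / ((n - 1 - s) * \<gamma> + s))"
      by (simp add: gap_def m_def t_def B_def)
    ultimately show ?thesis using nmt by linarith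
  qed
  moreover have "gap n b s \<gamma> w1 \<le> 0"
  proof -
    have "s * (m / (B - w1)) = n" using mt(1) a(1) n0 by (simp add: w1_def)
    moreover have "0 \<le> s * (t / ((n - 1 - s) * \<gamma> + s - w1))"
      using Q[of w1] w1(2) a(1) mt(2) by (intro mult_nonneg_nonneg divide_nonneg_nonneg) linarith+
    moreover have "gap n b s \<gamma> w1 = n - s - w1 - (s * (m / (B - w1)) + s * (t / ((n - 1 - s) * \<gamma> + s - w1)))"
      by (simp add: gap_def m_def t_def B_def distrib_left)
    ultimately show ?thesis using w1(1) a(1) by linarith
  qed
  moreover have "continuous_on {0..w1} (gap n b s \<gamma>)"
    unfolding gap_def
  proof (intro continuous_intros ballI)
    fix w assume w: "w \<in> {0..w1}"
    show "(b * s + 1) * \<gamma> + s - w \<noteq> 0" using w w1 by (simp add: B_def)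
    show "(n - 1 - s) * \<gamma> + s - w \<noteq> 0" using w w1 Q[of w] by auto
  qed
  ultimately obtain w where "0 \<le> w" "w \<le> w1" "gap n b s \<gamma> w = 0"
    using IVT2'[of "gap n b s \<gamma>" w1 0 0] w1 by auto
  then show ?thesis using w1 by (auto simp: B_def intro!: exI[of _ w])
qed

lemma gap_root:
  assumes "admissible n b s \<gamma>"
  shows "0 \<le> gap_root n b s \<gamma>" "gap_root n b s \<gamma> < (b * s + 1) * \<gamma> + s"
    "gap n b s \<gamma> (gap_root n b s \<gamma>) = 0"
proof -
  obtain w where w: "0 \<le> w" "w < (b * s + 1) * \<gamma> + s" "gap n b s \<gamma> w = 0"
    using gap_root_ex[OF assms] by blast
  have "gap_root n b s \<gamma> = w"
    unfolding gap_root_def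
  proof (rule the_equality)
    fix v assume "v < (b * s + 1) * \<gamma> + s \<and> gap n b s \<gamma> v = 0"
    then show "v = w"
      using gap_strict_antimono[OF assms, of v w] gap_strict_antimono[OF assms, of w v] w
      by (cases v w rule: linorder_cases) auto
  qed (use w in simp)
  then show "0 \<le> gap_root n b s \<gamma>" "gap_root n b s \<gamma> < (b * s + 1) * \<gamma> + s"
    "gap n b s \<gamma> (gap_root n b s \<gamma>) = 0" using w by simp_all
qed

lemma less_gap_root:
  assumes "admissible n b s \<gamma>" "w < (b * s + 1) * \<gamma> + s" "0 < gap n b s \<gamma> w"
  shows "w < gap_root n b s \<gamma>"
  using gap_strict_antimono[OF assms(1), of "gap_root n b s \<gamma>" w] gap_root[OF assms(1)] assms
  by (cases w "gap_root n b s \<gamma>" rule: linorder_cases) auto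

lemma gap_root_less:
  assumes "admissible n b s \<gamma>" "w < (b * s + 1) * \<gamma> + s" "gap n b s \<gamma> w < 0"
  shows "gap_root n b s \<gamma> < w"
  using gap_strict_antimono[OF assms(1), of w "gap_root n b s \<gamma>"] gap_root[OF assms(1)] assms
  by (cases w "gap_root n b s \<gamma>" rule: linorder_cases) auto

lemma gap_nonneg:
  assumes "admissible n b s \<gamma>" "w \<le> gap_root n b s \<gamma>"
  shows "0 \<le> gap n b s \<gamma> w"
  using gap_strict_antimono[OF assms(1), of w "gap_root n b s \<gamma>"] gap_root[OF assms(1)] assms
  by (cases "w = gap_root n b s \<gamma>") auto

lemma gap_root_less_order:
  assumes "admissible n b s \<gamma>"
  shows "gap_root n b s \<gamma> < n - s"
proof -
  note a = admissibleD[OF assms] and r = gap_root[OF assms]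
  define w where "w = gap_root n b s \<gamma>"
  have P: "0 < (b * s + 1) * \<gamma> + s - w" using r(2) by (simp add: w_def)
  have "0 < (n - 1 - (b + 1) * s) / ((b * s + 1) * \<gamma> + s - w)" using a(3) P by (intro divide_pos_pos) linarith+
  moreover have "0 < (b * s + 1) / ((n - 1 - s) * \<gamma> + s - w)"
    using a(5) P admissible_denominators[OF assms, of w] by (intro divide_pos_pos) linarith+
  ultimately have "0 < s * ((n - 1 - (b + 1) * s) / ((b * s + 1) * \<gamma> + s - w) + (b * s + 1) / ((n - 1 - s) * \<gamma> + s - w))"
    using a by simp
  then show ?thesis using r(3) unfolding gap_def w_def by linarith
qed

text \<open>The third divided difference of a cubic is its leading coefficient, here multiplied by
  the Vandermonde product to avoid division.\<close>

lemma cubic_interpolation: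
  fixes a b c d :: real
  assumes "\<And>x. f x = l * x ^ 3 + p * x ^ 2 + q * x + r"
  shows "f a * ((b - c) * (b - d) * (c - d)) - f b * ((a - c) * (a - d) * (c - d))
      + f c * ((a - b) * (a - d) * (b - d)) - f d * ((a - b) * (a - c) * (b - c))
    = l * ((a - b) * (a - c) * (a - d) * (b - c) * (b - d) * (c - d))"
  unfolding assms by (simp add: algebra_simps power2_eq_square power3_eq_cube)

lemma cubic_pos_between:
  fixes f :: "real \<Rightarrow> real"
  assumes f: "\<And>x. f x = l * x ^ 3 + p * x ^ 2 + q * x + r"
    and a: "a < s" "s < c" "0 \<le> f a" "0 \<le> f c"
    and ends: "0 \<le> l \<and> c < d \<and> f d < 0 \<or> l \<le> 0 \<and> d < a \<and> f d < 0"
  shows "0 < f s"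
proof (rule ccontr)
  assume "\<not> 0 < f s"
  then have fs: "f s \<le> 0" by simp
  have neg3: "x * y * z < 0" if "x < 0" "y < 0" "z < 0" for x y z :: real
    using that by (simp add: mult_less_0_iff zero_less_mult_iff)
  have neg6: "0 < u * v * w * x * y * z" if "u < 0" "v < 0" "w < 0" "x < 0" "y < 0" "z < 0" for u v w x y z :: real
    using that by (simp add: mult_less_0_iff zero_less_mult_iff)
  \<comment> \<open>The divided difference of \<open>f\<close> at \<open>a, s, c\<close> and the outer point \<open>d\<close> is \<open>l\<close>, which has the wrong sign.\<close>
  show False
    using ends
  proof (elim disjE conjE)
    assume d: "0 \<le> l" "c < d" "f d < 0"
    have "(s - c) * (s - d) * (c - d) < 0" "(a - c) * (a - d) * (c - d) < 0"
      "(a - s) * (a - d) * (s - d) < 0" "(a - s) * (a - c) * (s - c) < 0"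
      using a d by (auto intro!: neg3)
    then have "f a * ((s - c) * (s - d) * (c - d)) \<le> 0" "0 \<le> f s * ((a - c) * (a - d) * (c - d))"
      "f c * ((a - s) * (a - d) * (s - d)) \<le> 0" "0 < f d * ((a - s) * (a - c) * (s - c))"
      using a(3,4) d(3) fs by (simp_all only: mult_nonneg_nonpos mult_nonpos_nonpos mult_neg_neg less_imp_le)
    moreover have "0 \<le> l * ((a - s) * (a - c) * (a - d) * (s - c) * (s - d) * (c - d))"
      using a d by (intro mult_nonneg_nonneg less_imp_le[OF neg6]) auto
    ultimately show False using cubic_interpolation[of f, OF f, of a s c d] by linarith
  next
    assume d: "l \<le> 0" "d < a" "f d < 0"
    have "(a - s) * (a - c) * (s - c) < 0" "(d - s) * (d - c) * (s - c) < 0"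
      "(d - a) * (d - c) * (a - c) < 0" "(d - a) * (d - s) * (a - s) < 0"
      using a d by (auto intro!: neg3)
    then have "0 < f d * ((a - s) * (a - c) * (s - c))" "f a * ((d - s) * (d - c) * (s - c)) \<le> 0"
      "0 \<le> f s * ((d - a) * (d - c) * (a - c))" "f c * ((d - a) * (d - s) * (a - s)) \<le> 0"
      using a(3,4) d(3) fs by (simp_all only: mult_nonneg_nonpos mult_nonpos_nonpos mult_neg_neg less_imp_le)
    moreover have "l * ((d - a) * (d - s) * (d - c) * (a - s) * (a - c) * (s - c)) \<le> 0"
      using a d by (intro mult_nonpos_nonneg less_imp_le[OF neg6]) auto
    ultimately show False using cubic_interpolation[of f, OF f, of d a s c] by linarith
  qed
qed

text \<open>Meant for the smaller of the two end roots as \<open>w\<close>, where \<open>gap\<close>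
  is nonnegative at both ends. Multiplied by its positive denominators, \<open>gap\<close> becomes a
  cubic in s, and the alternative \<open>small\<close> supplies a negative value on the side that
  the sign of its leading coefficient requires.\<close>

lemma gap_root_interior:
  assumes adm: "admissible n b k \<gamma>" and s: "1 < s" "s < k" and g2: "2 < \<gamma>"
    and w: "w \<le> gap_root n b 1 \<gamma>" "w \<le> gap_root n b k \<gamma>"
    and small: "b + 2 \<le> \<gamma> \<or> \<gamma> < w"
  shows "w < gap_root n b s \<gamma>"
proof -
  have adm1: "admissible n b 1 \<gamma>" and adms: "admissible n b s \<gamma>"
    using admissible_mono[OF adm] s by auto
  note a = admissibleD[OF adm]
  define P where "P x = (b * x + 1) * \<gamma> + x - w" for x
  define Q where "Q x = (n - 1 - x) * \<gamma> + x - w" for x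
  define F where "F x = (n - x - w) * P x * Q x - x * ((n - 1 - (b + 1) * x) * Q x + (b * x + 1) * P x)" for x
  have PQ: "0 < P x" "0 < Q x" if "1 \<le> x" "x \<le> k" for x
  proof -
    have "P 1 \<le> P x"
    proof -
      have "b * \<gamma> * 1 \<le> b * \<gamma> * x" using that a by (intro mult_left_mono) auto
      then show ?thesis using that by (simp add: P_def algebra_simps)
    qed
    moreover have "0 < P 1" using gap_root(2)[OF adm1] w by (simp add: P_def)
    ultimately show "0 < P x" by simp
    then show "0 < Q x" using admissible_denominators[OF admissible_mono[OF adm that], of w] by (simp add: P_def Q_def)
  qed
  have F: "F x = gap n b x \<gamma> w * (P x * Q x)" if "1 \<le> x" "x \<le> k" for x
  proof -
    have "gap n b x \<gamma> w = n - x - w - x * ((n - 1 - (b + 1) * x) / P x + (b * x + 1) / Q x)"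
      by (simp add: gap_def P_def Q_def)
    then show ?thesis using PQ[OF that] by (simp add: F_def field_simps)
  qed
  have F1: "0 \<le> F 1" using F[of 1] PQ[of 1] gap_nonneg[OF adm1 w(1)] s by simp
  have Fk: "0 \<le> F k" using F[of k] PQ[of k] gap_nonneg[OF adm w(2)] s by simp
  \<comment> \<open>The cubic \<open>F\<close> is negative where \<open>Q\<close> vanishes and, if \<open>\<gamma> < w\<close>, at \<open>0\<close>; which of the two points is
    used depends on the sign of the leading coefficient.\<close>
  define R where "R = ((n - 1) * \<gamma> - w) / (\<gamma> - 1)"
  \<comment> \<open>This keeps the zero \<open>R\<close> of \<open>Q\<close> to the right of
    k.\<close>
  have wn: "w < n - k" using gap_root_less_order[OF adm] w by simp
  define X where "X = \<gamma> * (n - 1 - k)"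
  have "2 * (n - 1 - k) \<le> X" unfolding X_def using a(5,6) g2 by (intro mult_right_mono) linarith+
  then have "w < X + k" using wn a(1) order.trans[OF a(5,6)] by argo
  moreover have "(n - 1) * \<gamma> = X + k * \<gamma>" "k * (\<gamma> - 1) = k * \<gamma> - k"
    by (simp_all add: X_def algebra_simps)
  ultimately have "k * (\<gamma> - 1) < (n - 1) * \<gamma> - w" by linarith
  then have Rk: "k < R" using g2 by (simp add: R_def less_divide_eq)
  have QR: "Q R = 0"
  proof -
    have "R * (\<gamma> - 1) = (n - 1) * \<gamma> - w" using g2 by (simp add: R_def)
    then show ?thesis by (simp add: Q_def algebra_simps)
  qed
  have FR: "F R < 0"
  proof -
    have "P k \<le> P R"
    proof -
      have "b * \<gamma> * k \<le> b * \<gamma> * R" using Rk a by (intro mult_left_mono) auto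
      then show ?thesis using Rk by (simp add: P_def algebra_simps)
    qed
    then have "0 < P R" using PQ[of k] a by simp
    moreover have "0 < R" "0 < b * R + 1" using Rk a by (auto intro: add_nonneg_pos)
    ultimately show ?thesis by (simp add: F_def QR)
  qed
  define l where "l = b * \<gamma> * (\<gamma> - 2 - b)"
  obtain p q r where poly: "\<And>x. F x = l * x ^ 3 + p * x ^ 2 + q * x + r"
  proof
    define p1 p0 q1 q0 where "p1 = b * \<gamma> + 1" and "p0 = \<gamma> - w" and "q1 = 1 - \<gamma>" and "q0 = (n - 1) * \<gamma> - w"
    have Px: "P x = p1 * x + p0" and Qx: "Q x = q1 * x + q0" for x
      by (simp_all add: P_def Q_def p1_def p0_def q1_def q0_def algebra_simps)
    have l: "l = - p1 * q1 + (b + 1) * q1 - b * p1"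
      by (simp add: l_def p1_def q1_def algebra_simps)
    show "F x = l * x ^ 3
        + ((n - w) * p1 * q1 - p1 * q0 - p0 * q1 - (n - 1) * q1 + (b + 1) * q0 - b * p0 - p1) * x ^ 2
        + ((n - w) * (p1 * q0 + p0 * q1) - p0 * q0 - (n - 1) * q0 - p0) * x + (n - w) * p0 * q0" for x
      unfolding F_def Px Qx l by (simp add: algebra_simps power2_eq_square power3_eq_cube)
  qed
  have "0 < F s"
  proof (rule cubic_pos_between[OF poly s(1) s(2) F1 Fk])
    show "0 \<le> l \<and> k < (if b + 2 \<le> \<gamma> then R else 0) \<and> F (if b + 2 \<le> \<gamma> then R else 0) < 0 \<or>
        l \<le> 0 \<and> (if b + 2 \<le> \<gamma> then R else 0) < 1 \<and> F (if b + 2 \<le> \<gamma> then R else 0) < 0"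
    proof (cases "b + 2 \<le> \<gamma>")
      case True
      then have "0 \<le> l" using a by (simp add: l_def)
      then show ?thesis using True Rk FR by simp
    next
      case False
      then have "l \<le> 0" using a by (simp add: l_def mult_nonneg_nonpos)
      moreover have "F 0 = (n - w) * (\<gamma> - w) * ((n - 1) * \<gamma> - w)" by (simp add: F_def P_def Q_def)
      moreover have "0 < n - w" using wn a by linarith
      moreover have "\<gamma> - w < 0" using False small by simp
      moreover have "0 < (n - 1) * \<gamma> - w"
      proof -
        have "(n - 1) * 2 \<le> (n - 1) * \<gamma>" using a(1) order.trans[OF a(5,6)] g2 by (intro mult_left_mono) auto
        then show ?thesis using wn a(1) order.trans[OF a(5,6)] by argo
      qed
      ultimately have "F 0 < 0" by (simp add: mult_less_0_iff zero_less_mult_iff)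
      then show ?thesis using False \<open>l \<le> 0\<close> by simp
    qed
  qed
  then have "0 < gap n b s \<gamma> w * (P s * Q s)" using F[of s] s by simp
  moreover have "0 < P s * Q s" using PQ[of s] s by simp
  ultimately have "0 < gap n b s \<gamma> w" by (rule zero_less_mult_pos2)
  then show ?thesis using less_gap_root[OF adms] PQ[of s] s by (simp add: P_def)
qed

text \<open>Raising \<gamma> by h moves both poles up and so does not lower \<open>gap\<close>.
  Raising w by \<open>n * h\<close> at the same time outruns both poles, whose speeds
  \<open>b * s + 1\<close> and \<open>n - 1 - s\<close> are at most n; this crude constant is enough
  for continuity.\<close>

lemma gap_root_mono_Lipschitz:
  assumes adm: "admissible n b s \<gamma>" and h: "0 \<le> h"
  shows "gap_root n b s \<gamma> \<le> gap_root n b s (\<gamma> + h)"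
    and "gap_root n b s (\<gamma> + h) \<le> gap_root n b s \<gamma> + n * h"
proof -
  have adm': "admissible n b s (\<gamma> + h)" using adm h by (simp add: admissible_def)
  note a = admissibleD[OF adm] and r = gap_root[OF adm]
  define w where "w = gap_root n b s \<gamma>"
  define P Q where "P = (b * s + 1) * \<gamma> + s - w" and "Q = (n - 1 - s) * \<gamma> + s - w"
  have PQ: "0 < P" "0 < Q" using r(2) admissible_denominators[OF adm, of w] by (auto simp: P_def Q_def w_def)
  have th: "0 \<le> (b * s + 1) * h" "0 \<le> (n - 1 - s) * h"
    using a(5,6) h by (intro mult_nonneg_nonneg; linarith)+
  show "gap_root n b s \<gamma> \<le> gap_root n b s (\<gamma> + h)"
  proof (rule ccontr)
    assume less: "\<not> ?thesis"
    have b: "w < (b * s + 1) * (\<gamma> + h) + s" using r th by (simp add: w_def algebra_simps)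
    have "(n - 1 - (b + 1) * s) / (P + (b * s + 1) * h) \<le> (n - 1 - (b + 1) * s) / P"
      using PQ th a by (intro divide_left_mono) (auto intro!: mult_pos_pos add_pos_nonneg)
    moreover have "(b * s + 1) / (Q + (n - 1 - s) * h) \<le> (b * s + 1) / Q"
      using PQ th a by (intro divide_left_mono) (auto intro!: mult_pos_pos add_pos_nonneg)
    ultimately have "s * ((n - 1 - (b + 1) * s) / (P + (b * s + 1) * h) + (b * s + 1) / (Q + (n - 1 - s) * h)) \<le>
        s * ((n - 1 - (b + 1) * s) / P + (b * s + 1) / Q)" using a by (intro mult_left_mono) auto
    moreover have "gap n b s \<gamma> w = n - s - w - s * ((n - 1 - (b + 1) * s) / P + (b * s + 1) / Q)"
      by (simp add: gap_def P_def Q_def)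
    moreover have "gap n b s (\<gamma> + h) w = n - s - w -
        s * ((n - 1 - (b + 1) * s) / (P + (b * s + 1) * h) + (b * s + 1) / (Q + (n - 1 - s) * h))"
      by (simp add: gap_def P_def Q_def algebra_simps)
    ultimately have "0 \<le> gap n b s (\<gamma> + h) w" using r by (simp add: w_def)
    moreover have "gap n b s (\<gamma> + h) w < gap n b s (\<gamma> + h) (gap_root n b s (\<gamma> + h))"
      by (rule gap_strict_antimono[OF adm' _ b]) (use less in \<open>simp add: w_def\<close>)
    ultimately show False using gap_root(3)[OF adm'] by simp
  qed
  show "gap_root n b s (\<gamma> + h) \<le> gap_root n b s \<gamma> + n * h"
  proof (cases "w + n * h < (b * s + 1) * (\<gamma> + h) + s")
    case False
    then show ?thesis using gap_root(2)[OF adm'] by (simp add: w_def)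
  next
    case True
    define P' Q' where "P' = (b * s + 1) * (\<gamma> + h) + s - (w + n * h)"
      and "Q' = (n - 1 - s) * (\<gamma> + h) + s - (w + n * h)"
    have "(b * s + 1) * h \<le> n * h" "(n - 1 - s) * h \<le> n * h" using a h by (intro mult_right_mono; simp)+
    then have le: "P' \<le> P" "Q' \<le> Q" by (auto simp: P'_def P_def Q'_def Q_def algebra_simps)
    have pos: "0 < P'" "0 < Q'" using True admissible_denominators[OF adm', of "w + n * h"] by (auto simp: P'_def Q'_def)
    have "(n - 1 - (b + 1) * s) / P \<le> (n - 1 - (b + 1) * s) / P'" "(b * s + 1) / Q \<le> (b * s + 1) / Q'"
      using PQ le pos a by (auto intro!: divide_left_mono)
    then have "s * ((n - 1 - (b + 1) * s) / P + (b * s + 1) / Q) \<le> s * ((n - 1 - (b + 1) * s) / P' + (b * s + 1) / Q')"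
      using a by (intro mult_left_mono) auto
    moreover have "gap n b s \<gamma> w = n - s - w - s * ((n - 1 - (b + 1) * s) / P + (b * s + 1) / Q)"
      by (simp add: gap_def P_def Q_def)
    moreover have "gap n b s (\<gamma> + h) (w + n * h) = n - s - (w + n * h) -
        s * ((n - 1 - (b + 1) * s) / P' + (b * s + 1) / Q')"
      by (simp add: gap_def P'_def Q'_def)
    moreover have "0 \<le> n * h" using a(1,5,6) h by (intro mult_nonneg_nonneg) linarith+
    ultimately have "gap n b s (\<gamma> + h) (w + n * h) \<le> 0" using r by (simp add: w_def)
    then show ?thesis using less_gap_root gap_strict_antimono[OF adm', of "w + n * h" "gap_root n b s (\<gamma> + h)"]
        gap_root[OF adm'] by (force simp: w_def)
  qed
qed

lemma continuous_on_gap_root: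
  assumes "admissible n b s c"
  shows "continuous_on {c..d} (gap_root n b s)"
proof -
  have n0: "0 < n" using admissibleD[OF assms] by linarith
  have adm: "admissible n b s x" if "c \<le> x" for x using assms that by (simp add: admissible_def)
  have main: "\<bar>gap_root n b s x - gap_root n b s y\<bar> \<le> n * \<bar>x - y\<bar>" if "c \<le> x" "c \<le> y" for x y
  proof (cases "x \<le> y")
    case True
    then show ?thesis using gap_root_mono_Lipschitz[OF adm[OF that(1)], of "y - x"] by simp
  next
    case False
    then show ?thesis using gap_root_mono_Lipschitz[OF adm[OF that(2)], of "x - y"] by simp
  qed
  show ?thesis
    unfolding continuous_on_def tendsto_iff eventually_at dist_real_def
  proof (intro ballI allI impI)
    fix x e :: real assume x: "x \<in> {c..d}" "0 < e"
    show "\<exists>\<delta>>0. \<forall>y\<in>{c..d}. y \<noteq> x \<and> \<bar>y - x\<bar> < \<delta> \<longrightarrow> \<bar>gap_root n b s y - gap_root n b s x\<bar> < e"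
    proof (intro exI conjI ballI impI)
      show "0 < e / n" using x n0 by simp
      fix y assume y: "y \<in> {c..d}" "y \<noteq> x \<and> \<bar>y - x\<bar> < e / n"
      then have "n * \<bar>y - x\<bar> < e" using n0 by (simp add: less_divide_eq mult.commute)
      then show "\<bar>gap_root n b s y - gap_root n b s x\<bar> < e" using main[of y x] x y by auto
    qed
  qed
qed

section \<open>The crossing point\<close>

text \<open>
  Here \<open>m\<close> is the order of the clique \<open>K\<^sub>m\<close> in \<open>G\<^sub>k\<close>. The product \<open>b * k\<close> has a name of its own to keep the
  simplifier from cancelling factors in inequalities that are meant to stay linear in it.
\<close>

locale crossing =
  fixes n b k m c :: real
  assumes b3: "3 \<le> b" and k14: "14 \<le> k" and n_eq: "n = (b + 1) * k + 1 + m" and m: "1 \<le> m" "m \<le> b + 1"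
    and c: "c = b * k"
begin

lemma c_bounds: "14 * b \<le> c" "3 * k \<le> c" "b + 1 \<le> 4 / 3 * b"
  unfolding c using b3 k14 by (simp_all add: mult.commute mult_left_mono)

lemma n_eq': "n = c + k + 1 + m"
  using n_eq by (simp add: c algebra_simps)

lemma c_plus_k: "k * (b + 1) = c + k" "(b + 1) * k = c + k"
  by (simp_all add: c algebra_simps)

lemma adm: "1 < \<gamma> \<Longrightarrow> admissible n b k \<gamma>"
  using b3 k14 m n_eq by (simp add: admissible_def)

lemma adm1: "1 < \<gamma> \<Longrightarrow> admissible n b 1 \<gamma>"
  using admissible_mono[OF adm] k14 by simp

lemma gap_k: "gap n b k \<gamma> w = n - k - w - (k * m / ((c + 1) * \<gamma> + k - w) + k * (c + 1) / ((n - 1 - k) * \<gamma> + k - w))"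
  by (simp add: gap_def n_eq c algebra_simps)

lemma gap_1: "gap n b 1 \<gamma> w = n - 1 - w - ((n - b - 2) / ((b + 1) * \<gamma> + 1 - w) + (b + 1) / ((n - 2) * \<gamma> + 1 - w))"
  by (simp add: gap_def algebra_simps)

text \<open>Provides the alternative \<open>\<gamma> < w\<close> in \<open>gap_root_interior\<close>
  when \<gamma> < b + 2, from the sign of \<open>gap\<close> at w = \<gamma>.\<close>

lemma gamma_less_gap_roots:
  assumes "2 < \<gamma>" "\<gamma> < b + 2"
  shows "\<gamma> < gap_root n b 1 \<gamma>" and "\<gamma> < gap_root n b k \<gamma>"
proof -
  have bg: "0 \<le> b * \<gamma>" "6 \<le> b * \<gamma>" using b3 assms mult_mono[of 3 b 2 \<gamma>] by auto
  show "\<gamma> < gap_root n b 1 \<gamma>"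
  proof (rule less_gap_root)
    show "admissible n b 1 \<gamma>" using assms by (intro adm1) simp
    show "\<gamma> < (b * 1 + 1) * \<gamma> + 1" using bg by (simp add: algebra_simps)
    have "(n - b - 2) / ((b + 1) * \<gamma> + 1 - \<gamma>) \<le> (n - b - 2) / 7"
    proof (rule divide_left_mono)
      show "0 \<le> n - b - 2" using c_bounds b3 k14 m n_eq' by argo
      show "7 \<le> (b + 1) * \<gamma> + 1 - \<gamma>" using bg by (simp add: algebra_simps)
      then show "0 < ((b + 1) * \<gamma> + 1 - \<gamma>) * 7" by simp
    qed
    moreover have "(n - 2) * 2 \<le> (n - 2) * \<gamma>" using assms c_bounds b3 k14 m n_eq' by (intro mult_left_mono) auto
    then have "(b + 1) / ((n - 2) * \<gamma> + 1 - \<gamma>) \<le> 1"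
      using assms c_bounds b3 k14 m n_eq' by (simp add: divide_le_eq)
    ultimately show "0 < gap n b 1 \<gamma> \<gamma>"
      unfolding gap_1 using assms c_bounds b3 k14 m n_eq' by argo
  qed
  show "\<gamma> < gap_root n b k \<gamma>"
  proof (rule less_gap_root)
    show "admissible n b k \<gamma>" using assms by (intro adm) simp
    have "c * 2 \<le> c * \<gamma>" using assms c_bounds b3 by (intro mult_left_mono) auto
    then have P: "c + k \<le> (c + 1) * \<gamma> + k - \<gamma>" using c_bounds b3 by (simp add: algebra_simps)
    then show "\<gamma> < (b * k + 1) * \<gamma> + k" using c_bounds b3 k14 unfolding c by argo
    have "0 < c + k" using c_bounds b3 k14 by simp
    moreover have "k * m \<le> c + k" using mult_left_mono[OF m(2), of k] k14 c_plus_k by simp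
    ultimately have "k * m / ((c + 1) * \<gamma> + k - \<gamma>) \<le> 1" using P by (simp add: divide_le_eq)
    moreover have "(n - 2 - k) * 2 \<le> (n - 2 - k) * \<gamma>" using assms c_bounds b3 k14 m n_eq' by (intro mult_left_mono) auto
    then have Q: "c + 1 \<le> (n - 1 - k) * \<gamma> + k - \<gamma>" using c_bounds b3 k14 m n_eq' by (simp add: algebra_simps)
    then have "k * (c + 1) \<le> k * ((n - 1 - k) * \<gamma> + k - \<gamma>)" using k14 by (intro mult_left_mono) auto
    then have "k * (c + 1) / ((n - 1 - k) * \<gamma> + k - \<gamma>) \<le> k" using Q c_bounds b3 by (simp add: divide_le_eq)
    ultimately show "0 < gap n b k \<gamma> \<gamma>"
      unfolding gap_k using assms c_bounds b3 k14 m n_eq' by argo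
  qed
qed

text \<open>The test value \<open>3 * b + 4\<close> is the first pole for s = 1 at \<gamma> = 3. The
  root for s = 1 lies below it, while \<open>gap\<close> for s = k is still positive there.\<close>

lemma gap_root_1_less_k: "gap_root n b 1 3 < gap_root n b k 3"
proof -
  have "gap_root n b 1 3 < 3 * b + 4" using gap_root(2)[OF adm1, of 3] by (simp add: algebra_simps)
  also have "3 * b + 4 < gap_root n b k 3"
  proof (rule less_gap_root)
    show "admissible n b k 3" using adm[of 3] by simp
    have P: "c + k \<le> (c + 1) * 3 + k - (3 * b + 4)" using c_bounds b3 by (simp add: algebra_simps)
    show "3 * b + 4 < (b * k + 1) * 3 + k" using c_bounds b3 k14 unfolding c by argo
    have "0 < c + k" using c_bounds b3 k14 by simp
    moreover have "k * m \<le> c + k" using mult_left_mono[OF m(2), of k] k14 c_plus_k by simp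
    ultimately have "k * m / ((c + 1) * 3 + k - (3 * b + 4)) \<le> 1" using P by (simp add: divide_le_eq)
    moreover have Q: "c + 1 \<le> (n - 1 - k) * 3 + k - (3 * b + 4)" using c_bounds b3 k14 m n_eq' by simp
    then have "k * (c + 1) \<le> k * ((n - 1 - k) * 3 + k - (3 * b + 4))" using k14 by (intro mult_left_mono) auto
    then have "k * (c + 1) / ((n - 1 - k) * 3 + k - (3 * b + 4)) \<le> k" using Q c_bounds b3 by (simp add: divide_le_eq)
    moreover have "b * 14 - 14 \<le> c - k" using mult_mono[of 14 k 2 "b - 1"] b3 k14 mult_left_mono[of 14 k "b - 1"] by (simp add: c algebra_simps)
    ultimately show "0 < gap n b k 3 (3 * b + 4)"
      unfolding gap_k using c_bounds b3 k14 m n_eq' by argo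
  qed
  finally show ?thesis .
qed

text \<open>The root for s = k never reaches \<open>n - k\<close>. At this test value and \<gamma> =
  n, both fractions for s = 1 are at most 1, so \<open>gap\<close> is still positive.\<close>

lemma gap_root_k_less_1: "gap_root n b k n < gap_root n b 1 n"
proof -
  have n4: "14 * b + 15 \<le> n" using c_bounds k14 m n_eq' by simp
  have "gap_root n b k n < n - k" using b3 n4 by (intro gap_root_less_order adm) simp
  also have "n - k < gap_root n b 1 n"
  proof (rule less_gap_root)
    show "admissible n b 1 n" using b3 n4 by (intro adm1) simp
    have bn: "n \<le> b * n" using b3 n4 by simp
    then show "n - k < (b * 1 + 1) * n + 1" using k14 n4 b3 bn by (simp only: algebra_simps)
    have D: "(b + 1) * n + 1 - (n - k) = b * n + 1 + k" by (simp add: algebra_simps)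
    have "(n - b - 2) / ((b + 1) * n + 1 - (n - k)) \<le> 1"
    proof -
      define bn where "bn = b * n"
      have "n \<le> bn" using b3 n4 by (simp add: bn_def)
      then show ?thesis unfolding D bn_def[symmetric] using n4 b3 k14 by (simp add: divide_le_eq)
    qed
    moreover have "4 * (n - 2) \<le> n * (n - 2)" using n4 b3 by (intro mult_right_mono) auto
    then have "(b + 1) / ((n - 2) * n + 1 - (n - k)) \<le> 1" using n4 b3 k14 by (simp add: divide_le_eq algebra_simps)
    ultimately show "0 < gap n b 1 n (n - k)" unfolding gap_1 using k14 by simp
  qed
  finally show ?thesis .
qed

text \<open>A bootstrap. From \<gamma> > 2 alone, the fractions in the equation for k give
  \<open>n - k - w \<le> k + 4 / 3\<close>. As w also lies below the first pole for s = 1, \<gamma>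
  is forced to be of order k / 2. Then the denominators are at least of order \<open>c * k\<close>,
  and the same fractions shrink to constants.\<close>

lemma crossing_bounds:
  assumes g: "2 < \<gamma>" and le: "gap_root n b k \<gamma> \<le> gap_root n b 1 \<gamma>"
  defines "w \<equiv> gap_root n b k \<gamma>"
  defines "P \<equiv> (c + 1) * \<gamma> + k - w" and "Q \<equiv> (n - 1 - k) * \<gamma> + k - w"
  shows "21 / 50 * k \<le> \<gamma> - 1" "2 / 5 * c * k \<le> P" "(n - 1 - k) * (\<gamma> - 1) \<le> Q" "n - k - w \<le> 3"
proof -
  have ad: "admissible n b k \<gamma>" "admissible n b 1 \<gamma>" using g adm adm1 by auto
  define y where "y = n - k - w"
  have y0: "0 < y" using gap_root_less_order[OF ad(1)] by (simp add: y_def w_def)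
  have y: "y = k * m / P + k * (c + 1) / Q"
    using gap_root(3)[OF ad(1)] unfolding gap_k by (simp add: y_def w_def P_def Q_def)
  have P_eq: "P = c * (\<gamma> - 1) + (\<gamma> - 1) + k - m + y" by (simp add: P_def y_def n_eq' algebra_simps)
  have Q_eq: "Q = (n - 1 - k) * (\<gamma> - 1) + (k - 1) + y" by (simp add: Q_def y_def algebra_simps)
  show Q1: "(n - 1 - k) * (\<gamma> - 1) \<le> Q" using Q_eq y0 k14 by simp
  have bk1: "c * 1 \<le> c * (\<gamma> - 1)" using g c_bounds b3 k14 by (intro mult_left_mono) auto
  have nk: "(n - 1 - k) * 1 \<le> (n - 1 - k) * (\<gamma> - 1)" using g c_bounds b3 k14 m n_eq' by (intro mult_left_mono) auto
  have km: "k * m \<le> c + k" using mult_left_mono[OF m(2), of k] k14 c_plus_k by simp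
  have kb: "0 \<le> k * (c + 1)" using c_bounds b3 k14 by simp
  have y1: "y \<le> k + 4 / 3"
  proof -
    have P1: "c + 1 + k - m \<le> P" using P_eq bk1 g y0 by simp
    have Ppos: "0 < P" using P1 m c_bounds b3 k14 by argo
    have "3 * (c + k) \<le> 4 * (c + 1 + k - m)" using m c_bounds b3 k14 by (simp add: algebra_simps)
    then have "k * m \<le> 4 / 3 * P" using km P1 by argo
    then have "k * m / P \<le> 4 / 3" using Ppos by (simp add: divide_le_eq)
    moreover have Q2: "c + 1 \<le> Q" using order.trans[OF nk Q1] m n_eq' by argo
    then have "k * (c + 1) \<le> k * Q" using k14 by (intro mult_left_mono) auto
    then have "k * (c + 1) / Q \<le> k" using Q2 c_bounds b3 by (simp add: divide_le_eq)
    ultimately show ?thesis using y by argo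
  qed
  have "w < (b + 1) * \<gamma> + 1" using gap_root(2)[OF ad(2)] le by (simp add: w_def)
  \<comment> \<open>The loss 1 / 12 absorbs the constant 1 / 3 left by the estimates, since b + 1
    \<ge> 4. With k \<ge> 14 the resulting bound gives \<open>21 / 50 * k\<close> for \<gamma> -
    1.\<close>
  moreover have "(b + 1) * (k / 2 - 1 / 12) = (c + k) / 2 - (b + 1) / 12" by (simp add: c field_simps)
  ultimately have "(b + 1) * (k / 2 - 1 / 12) < (b + 1) * \<gamma>"
    using y1 n_eq' m c_bounds b3 k14 unfolding y_def by argo
  then have "k / 2 - 1 / 12 < \<gamma>" using b3 by simp
  then show g1: "21 / 50 * k \<le> \<gamma> - 1" using k14 by simp
  have "c * (21 / 50 * k) \<le> c * (\<gamma> - 1)" using g1 c_bounds b3 k14 by (intro mult_left_mono) auto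
  moreover have "14 * (14 * b) \<le> k * c" using c_bounds b3 k14 by (intro mult_mono) auto
  ultimately show P2: "2 / 5 * c * k \<le> P" using P_eq m b3 k14 g y0 by (simp add: algebra_simps)
  have "k * m / P \<le> 1 / 4"
  proof -
    have pos: "0 < 2 / 5 * c * k" using c_bounds b3 k14 by simp
    have "14 * c \<le> k * c" using c_bounds b3 k14 by (intro mult_right_mono) auto
    moreover have "2 / 5 * c * k = 2 / 5 * (k * c)" by simp
    ultimately have "k * m \<le> 1 / 4 * P" using km P2 c_bounds b3 by linarith
    then show ?thesis using pos P2 by (simp add: divide_le_eq)
  qed
  \<comment> \<open>12 / 5 rounds up the reciprocal of 21 / 50.\<close>
  moreover have "k * (c + 1) / Q \<le> 12 / 5"
  proof -
    have "(c + 1) * (21 / 50 * k) \<le> (n - 1 - k) * (\<gamma> - 1)"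
      using g1 c_bounds b3 k14 m n_eq' by (intro mult_mono) auto
    then have q: "(c + 1) * (21 / 50 * k) \<le> Q" using Q1 by argo
    have "0 < (c + 1) * (21 / 50 * k)" using c_bounds b3 k14 by (intro mult_pos_pos) auto
    moreover have "(c + 1) * (21 / 50 * k) = 21 / 50 * (k * (c + 1))" by simp
    ultimately have "0 < Q" "k * (c + 1) \<le> 12 / 5 * Q" using q kb by linarith+
    then show ?thesis by (simp add: divide_le_eq)
  qed
  ultimately show "n - k - w \<le> 3" using y by (simp add: y_def)
qed

lemma inverse_decrease:
  fixes P d :: real
  assumes "0 < P" "0 \<le> d"
  shows "x / P - x / (P + d) = x * d / (P * (P + d))"
  using assms by (simp add: field_simps)

text \<open>Moving both \<gamma> and w by h adds \<open>c * h\<close> and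
  \<open>(n - 2 - k) * h\<close> to the denominators. The fractions drop by at most
  \<open>2 / 5 * h\<close> and \<open>1 / 2 * h\<close>, together less than the h lost in the linear
  term, so \<open>gap\<close> becomes negative.\<close>

lemma gap_root_k_slow:
  assumes g: "2 < \<gamma>" and le: "gap_root n b k \<gamma> \<le> gap_root n b 1 \<gamma>" and h: "0 < h"
  shows "gap_root n b k (\<gamma> + h) < gap_root n b k \<gamma> + h"
proof (rule gap_root_less)
  define w P Q where "w = gap_root n b k \<gamma>" and "P = (c + 1) * \<gamma> + k - w" and "Q = (n - 1 - k) * \<gamma> + k - w"
  note cb = crossing_bounds[OF g le, folded w_def, folded P_def Q_def]
  have ad: "admissible n b k \<gamma>" using g adm by auto
  show "admissible n b k (\<gamma> + h)" using g h adm by auto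
  have kbh: "0 \<le> c * h" using c_bounds b3 k14 h by simp
  then show "gap_root n b k \<gamma> + h < (b * k + 1) * (\<gamma> + h) + k"
    using gap_root(2)[OF ad] by (simp add: c algebra_simps)
  have eqP: "(c + 1) * (\<gamma> + h) + k - (w + h) = P + c * h" by (simp add: P_def algebra_simps)
  have eqQ: "(n - 1 - k) * (\<gamma> + h) + k - (w + h) = Q + (n - 2 - k) * h" by (simp add: Q_def algebra_simps)
  have nkh: "0 \<le> (n - 2 - k) * h" using c_bounds b3 k14 m n_eq' h by (intro mult_nonneg_nonneg) auto
  have Ppos: "0 < P" using gap_root(2)[OF ad] by (simp add: P_def w_def c)
  \<comment> \<open>This is 21 / 50 times 14.\<close>
  have g1: "(147 / 25) \<le> \<gamma> - 1" using cb(1) k14 by argo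
  have nk: "c + 1 \<le> n - 1 - k" using m n_eq' by simp
  have "(n - 1 - k) * (147 / 25) \<le> (n - 1 - k) * (\<gamma> - 1)" using g1 nk c_bounds b3 by (intro mult_left_mono) auto
  then have Q1: "(n - 1 - k) * (147 / 25) \<le> Q" using cb(3) by argo
  have Qpos: "0 < Q" using Q1 nk c_bounds b3 by argo
  have "k * m / P - k * m / (P + c * h) \<le> 2 / 5 * h"
  proof -
    have "k * m * (c * h) \<le> 2 / 5 * h * (P * P)"
    proof -
      have "k * m * c \<le> 4 / 3 * c * c"
      proof (rule mult_right_mono)
        have "k * m \<le> c + k" using mult_left_mono[OF m(2), of k] k14 c_plus_k by simp
        then show "k * m \<le> 4 / 3 * c" using c_bounds by linarith
      qed (use c_bounds b3 in simp)
      also have "\<dots> \<le> 2 / 5 * ((2 / 5 * c * k) * (2 / 5 * c * k))"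
      proof -
        have "196 \<le> k * k" using mult_mono[of 14 k 14 k] k14 by simp
        then have "c * c * 196 \<le> c * c * (k * k)" using b3 k14 by (intro mult_left_mono) auto
        moreover have "0 \<le> c * c" by simp
        moreover have "2 / 5 * ((2 / 5 * c * k) * (2 / 5 * c * k)) = 8 / 125 * (c * c * (k * k))"
          by (simp add: algebra_simps)
        ultimately show ?thesis by linarith
      qed
      also have "\<dots> \<le> 2 / 5 * (P * P)" using cb(2) Ppos c_bounds b3 k14 by (intro mult_left_mono mult_mono) auto
      finally show ?thesis using mult_right_mono[of "k * m * c" "2 / 5 * (P * P)" h] h by (simp add: algebra_simps)
    qed
    also have "\<dots> \<le> 2 / 5 * h * (P * (P + c * h))" using Ppos h kbh by (intro mult_left_mono) auto
    finally show ?thesis using Ppos kbh by (subst inverse_decrease) (auto simp: divide_le_eq add_pos_nonneg)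
  qed
  moreover have "k * (c + 1) / Q - k * (c + 1) / (Q + (n - 2 - k) * h) \<le> 1 / 2 * h"
  proof -
    have "k * (c + 1) \<le> 12 / 5 * Q"
    proof -
      have "(c + 1) * (21 / 50 * k) \<le> (n - 1 - k) * (\<gamma> - 1)"
        using cb(1) nk c_bounds b3 k14 by (intro mult_mono) auto
      moreover have "0 \<le> k * (c + 1)" using c_bounds b3 k14 by simp
      moreover have "(c + 1) * (21 / 50 * k) = 21 / 50 * (k * (c + 1))" by simp
      ultimately show ?thesis using cb(3) by linarith
    qed
    moreover have "n - 2 - k \<le> 1 / 5 * Q" using Q1 nk c_bounds b3 by argo
    ultimately have "k * (c + 1) * (n - 2 - k) \<le> 12 / 5 * Q * (1 / 5 * Q)"
    proof (rule mult_mono)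
      show "0 \<le> 12 / 5 * Q" using Qpos by simp
      show "0 \<le> n - 2 - k" using c_bounds b3 k14 m n_eq' by simp
    qed
    also have "\<dots> \<le> 1 / 2 * (Q * Q)" using Qpos by simp
    finally have "k * (c + 1) * ((n - 2 - k) * h) \<le> 1 / 2 * h * (Q * Q)"
      using mult_right_mono[of "k * (c + 1) * (n - 2 - k)" "1 / 2 * (Q * Q)" h] h by (simp add: mult.assoc mult.commute mult.left_commute)
    also have "\<dots> \<le> 1 / 2 * h * (Q * (Q + (n - 2 - k) * h))" using Qpos h nkh by (intro mult_left_mono) auto
    finally show ?thesis using Qpos nkh by (subst inverse_decrease) (auto simp: divide_le_eq add_pos_nonneg)
  qed
  moreover have "gap n b k \<gamma> w = 0" using gap_root(3)[OF ad] by (simp add: w_def)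
  ultimately have "gap n b k (\<gamma> + h) (w + h) < 0"
    unfolding gap_k eqP eqQ P_def[symmetric] Q_def[symmetric] using h by argo
  then show "gap n b k (\<gamma> + h) (gap_root n b k \<gamma> + h) < 0" by (simp add: w_def)
qed

text \<open>At \<gamma> + h the equation for s = 1 is tested at the new root \<open>w'\<close> for
  k. Either the first denominator is so large that \<open>n - 1 - w' > k - 1\<close> outweighs both
  fractions, or the old and new denominators are both small and the drop of the first fraction
  covers the increase \<open>e\<close> of w.\<close>

lemma gap_roots_cross_once:
  assumes g: "2 < \<gamma>" and le: "gap_root n b k \<gamma> \<le> gap_root n b 1 \<gamma>" and h: "0 < h"
  shows "gap_root n b k (\<gamma> + h) < gap_root n b 1 (\<gamma> + h)"
proof (rule less_gap_root)
  define w w' e where "w = gap_root n b k \<gamma>" and "w' = gap_root n b k (\<gamma> + h)" and "e = w' - w"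
  have ad: "admissible n b 1 \<gamma>" "admissible n b k \<gamma>" "admissible n b 1 (\<gamma> + h)" "admissible n b k (\<gamma> + h)"
    using g h adm adm1 by auto
  then show "admissible n b 1 (\<gamma> + h)" by simp
  have e: "0 \<le> e" "e < h" using gap_root_mono_Lipschitz(1)[OF ad(2), of h] gap_root_k_slow[OF g le h] h
    by (auto simp: e_def w_def w'_def)
  define P P' Q Q' where "P = (b + 1) * \<gamma> + 1 - w" and "P' = (b + 1) * (\<gamma> + h) + 1 - w'"
    and "Q = (n - 2) * \<gamma> + 1 - w" and "Q' = (n - 2) * (\<gamma> + h) + 1 - w'"
  have P: "0 < P" using gap_root(2)[OF ad(1)] le by (simp add: P_def w_def)
  have be: "b * e \<le> b * h" using e b3 by simp
  \<comment> \<open>The pole moves by \<open>(b + 1) * h\<close> and the root only by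
    \<open>e < h\<close>; this is where the slope bound is used.\<close>
  have PP': "P + b * e < P'" using be e by (simp add: P_def P'_def e_def algebra_simps)
  have be0: "0 \<le> b * e" using e b3 by simp
  then have P': "0 < P'" "P \<le> P'" using P PP' by argo+
  show "gap_root n b k (\<gamma> + h) < (b * 1 + 1) * (\<gamma> + h) + 1" using P' by (simp add: P'_def w'_def)
  define M where "M = n - b - 2"
  have M: "0 < M" "M \<le> c + k" using c_bounds b3 k14 m n_eq' by (auto simp: M_def n_eq)
  have w'n: "w' < n - k" "w < n - k" using gap_root_less_order[OF ad(4)] gap_root_less_order[OF ad(2)] by (auto simp: w'_def w_def)
  have "(n - 2) * 2 \<le> (n - 2) * \<gamma>" using g c_bounds b3 k14 m n_eq' by (intro mult_left_mono) auto
  then have Q: "b + 1 < Q" using w'n c_bounds b3 k14 m n_eq' by (simp add: Q_def)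
  have "1 * h < (n - 2) * h" using h c_bounds b3 k14 m n_eq' by (intro mult_strict_right_mono) auto
  then have QQ': "Q < Q'" using e by (simp only: Q_def Q'_def e_def algebra_simps)
  have "(b + 1) / Q' < (b + 1) / Q" using QQ' Q b3 by (intro divide_strict_left_mono) auto
  have Q'1: "(b + 1) / Q' < 1" using QQ' Q b3 by simp
  have gap': "gap n b 1 (\<gamma> + h) w' = n - 1 - w' - (M / P' + (b + 1) / Q')"
    by (simp add: gap_1 M_def P'_def Q'_def)
  have "0 < gap n b 1 (\<gamma> + h) w'"
  proof (cases "M / (k - 2) \<le> P'")
    case True
    then have "M / P' \<le> k - 2" using k14 P' by (simp add: divide_le_eq mult.commute)
    then show ?thesis using gap' Q'1 w'n by simp
  next
    case False
    then have less: "P' < M / (k - 2)" by simp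
    have "P * P' \<le> M / (k - 2) * (M / (k - 2))" using less P P' by (intro mult_mono) auto
    also have "\<dots> \<le> M * b"
    proof -
      have "14 * k \<le> k * k" using k14 by (intro mult_right_mono) auto
      moreover have "(k - 2) * (k - 2) = k * k - 4 * k + 4" by (simp add: algebra_simps)
      ultimately have "4 / 3 * k \<le> (k - 2) * (k - 2)" using k14 by argo
      then have "b * (4 / 3 * k) \<le> b * ((k - 2) * (k - 2))" using b3 by (intro mult_left_mono) auto
      moreover have "c + k \<le> 4 / 3 * c" using c_bounds by linarith
      moreover have "b * (4 / 3 * k) = 4 / 3 * c" by (simp add: c)
      ultimately have "M \<le> b * ((k - 2) * (k - 2))" using M by linarith
      then have "M * M \<le> M * (b * ((k - 2) * (k - 2)))" using M by (intro mult_left_mono) auto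
      then show ?thesis using k14 by (simp add: divide_le_eq mult.assoc)
    qed
    \<comment> \<open>The drop of \<open>M / P\<close> is \<open>M * (P' - P) / (P * P')\<close>,
      hence at least \<open>(P' - P) / b\<close>, which exceeds \<open>e\<close>.\<close>
    finally have PM: "P * P' \<le> M * b" .
    have "e \<le> M / P - M / P'"
    proof -
      have "e * (P * P') \<le> e * (M * b)" using e PM by (intro mult_left_mono) auto
      also have "\<dots> = M * (b * e)" by simp
      also have "\<dots> \<le> M * (P' - P)" using M PP' by (intro mult_left_mono) auto
      finally have "e \<le> M * (P' - P) / (P * P')" using P P' by (simp add: le_divide_eq)
      then show ?thesis using inverse_decrease[of P "P' - P" M] P P' by simp
    qed
    moreover have "0 \<le> gap n b 1 \<gamma> w" using gap_nonneg[OF ad(1)] le by (simp add: w_def)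
    moreover have "gap n b 1 \<gamma> w = n - 1 - w - (M / P + (b + 1) / Q)"
      by (simp add: gap_1 M_def P_def Q_def)
    ultimately show ?thesis using gap' \<open>(b + 1) / Q' < (b + 1) / Q\<close> by (simp add: e_def)
  qed
  then show "0 < gap n b 1 (\<gamma> + h) (gap_root n b k (\<gamma> + h))" by (simp add: w'_def)
qed

text \<open>Existence is the intermediate value theorem on [3, n]. The strict order on both sides
  comes from \<open>gap_roots_cross_once\<close>, started at g0 on the right and, for a
  contradiction, at \<gamma> on the left.\<close>

lemma crossing_point:
  obtains g0 where "2 < g0" "gap_root n b 1 g0 = gap_root n b k g0"
    "\<And>\<gamma>. 2 < \<gamma> \<Longrightarrow> \<gamma> < g0 \<Longrightarrow> gap_root n b 1 \<gamma> < gap_root n b k \<gamma>"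
    "\<And>\<gamma>. g0 < \<gamma> \<Longrightarrow> gap_root n b k \<gamma> < gap_root n b 1 \<gamma>"
proof -
  have n3: "3 \<le> n" using c_bounds b3 k14 m n_eq' by simp
  define d where "d x = gap_root n b 1 x - gap_root n b k x" for x
  have "continuous_on {3..n} d"
    unfolding d_def by (intro continuous_on_diff continuous_on_gap_root adm adm1) auto
  then obtain g0 where g0: "3 \<le> g0" "g0 \<le> n" "d g0 = 0"
    using IVT'[of d 3 0 n] gap_root_1_less_k gap_root_k_less_1 n3 by (auto simp: d_def)
  show thesis
  proof
    show "2 < g0" using g0 by simp
    show "gap_root n b 1 g0 = gap_root n b k g0" using g0 by (simp add: d_def)
    then show "gap_root n b k \<gamma> < gap_root n b 1 \<gamma>" if "g0 < \<gamma>" for \<gamma>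
      using gap_roots_cross_once[of g0 "\<gamma> - g0"] g0 that by simp
    show "gap_root n b 1 \<gamma> < gap_root n b k \<gamma>" if "2 < \<gamma>" "\<gamma> < g0" for \<gamma>
      using gap_roots_cross_once[of \<gamma> "g0 - \<gamma>"] g0 that by (force simp: d_def)
  qed
qed

end

section \<open>Spectral radius and test functions\<close>

text \<open>The action of the matrix without an enumeration of the vertices. Values lie in any real
  vector space, so that complex eigenvectors and real test functions share the definition.\<close>

definition A_apply :: "real \<Rightarrow> 'a pair_pre_digraph \<Rightarrow> ('a \<Rightarrow> 'b) \<Rightarrow> 'a \<Rightarrow> 'b :: real_vector" where
  "A_apply \<alpha> G X v = (\<Sum>u | (v, u) \<in> parcs G. \<alpha> *\<^sub>R X v + (1 - \<alpha>) *\<^sub>R X u)"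

lemma (in pair_graph) finite_neighbours: "finite {u. (v, u) \<in> parcs G}"
  by (rule finite_subset[OF _ pair_finite_verts]) (auto dest: in_arcsD2)

lemma A_matrix_mult_vec:
  fixes X :: "'a \<Rightarrow> complex"
  assumes G: "pair_graph G" and vs: "distinct vs" "set vs = pverts G" and i: "i < length vs"
  shows "(map_mat complex_of_real (A_matrix \<alpha> vs G) *\<^sub>v vec (length vs) (\<lambda>j. X (vs ! j))) $ i =
    A_apply \<alpha> G X (vs ! i)"
proof -
  interpret pair_graph G by (rule G)
  let ?v = "vs ! i" and ?l = "length vs"
  let ?N = "{u. (?v, u) \<in> parcs G}"
  have N: "?N \<subseteq> set vs" using in_arcsD2 vs by auto
  have v: "?v \<in> set vs" using i by simp
  have "out_arcs (with_proj G) ?v = Pair ?v ` ?N" by (auto simp: out_arcs_def)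
  then have deg: "out_degree (with_proj G) ?v = card ?N"
    by (simp add: out_degree_def card_image inj_on_def)
  have bij: "bij_betw ((!) vs) {..<?l} (set vs)" using vs by (simp add: bij_betw_nth)
  have "(map_mat complex_of_real (A_matrix \<alpha> vs G) *\<^sub>v vec ?l (\<lambda>j. X (vs ! j))) $ i =
      (\<Sum>j<?l. complex_of_real (A_matrix \<alpha> vs G $$ (i, j)) * X (vs ! j))"
    using i A_matrix_carrier[of \<alpha> vs G] by (auto simp: scalar_prod_def atLeast0LessThan intro!: sum.cong)
  also have "\<dots> = (\<Sum>j<?l. (if vs ! j = ?v then complex_of_real (\<alpha> * card ?N) * X ?v else 0) +
      (if vs ! j \<in> ?N then complex_of_real (1 - \<alpha>) * X (vs ! j) else 0))"
  proof (rule sum.cong)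
    fix j assume "j \<in> {..<?l}"
    then have "j < ?l" "vs ! j = ?v \<longleftrightarrow> i = j" using i vs nth_eq_iff_index_eq by auto
    then show "complex_of_real (A_matrix \<alpha> vs G $$ (i, j)) * X (vs ! j) =
        (if vs ! j = ?v then complex_of_real (\<alpha> * card ?N) * X ?v else 0) +
        (if vs ! j \<in> ?N then complex_of_real (1 - \<alpha>) * X (vs ! j) else 0)"
      using i deg by (cases "j = i") (simp_all add: A_matrix_def degree_matrix_def adjacency_matrix_def distrib_right)
  qed simp
  also have "\<dots> = (\<Sum>u\<in>set vs. (if u = ?v then complex_of_real (\<alpha> * card ?N) * X ?v else 0) +
      (if u \<in> ?N then complex_of_real (1 - \<alpha>) * X u else 0))"
    by (rule sum.reindex_bij_betw[OF bij])
  also have "\<dots> = complex_of_real (\<alpha> * card ?N) * X ?v + (\<Sum>u\<in>set vs \<inter> ?N. complex_of_real (1 - \<alpha>) * X u)"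
    using v by (simp only: sum.distrib sum.inter_restrict[OF finite_set]) (simp add: sum.delta)
  also have "set vs \<inter> ?N = ?N" using N by auto
  also have "complex_of_real (\<alpha> * card ?N) * X ?v + (\<Sum>u\<in>?N. complex_of_real (1 - \<alpha>) * X u) = A_apply \<alpha> G X ?v"
    by (simp add: A_apply_def sum.distrib scaleR_conv_of_real)
  finally show ?thesis .
qed

lemma eigenvalue_A_matrix_iff:
  assumes G: "pair_graph G" and vs: "distinct vs" "set vs = pverts G"
  shows "eigenvalue (map_mat complex_of_real (A_matrix \<alpha> vs G)) \<mu> \<longleftrightarrow>
    (\<exists>X. (\<exists>v\<in>pverts G. X v \<noteq> 0) \<and> (\<forall>v\<in>pverts G. A_apply \<alpha> G X v = \<mu> * X v))"
    (is "eigenvalue ?M \<mu> \<longleftrightarrow> ?R")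
proof -
  let ?l = "length vs"
  have dim: "dim_row ?M = ?l" "dim_col ?M = ?l" using A_matrix_carrier[of \<alpha> vs G] by simp_all
  show ?thesis
  proof
    assume "eigenvalue ?M \<mu>"
    then obtain x where x: "x \<in> carrier_vec ?l" "x \<noteq> 0\<^sub>v ?l" "?M *\<^sub>v x = \<mu> \<cdot>\<^sub>v x"
      unfolding eigenvalue_def eigenvector_def dim by blast
    define X where "X v = x $ the_inv_into {..<?l} ((!) vs) v" for v
    have X: "X (vs ! j) = x $ j" if "j < ?l" for j
      using that vs by (simp add: X_def the_inv_into_f_f inj_on_nth)
    have x_eq: "x = vec ?l (\<lambda>j. X (vs ! j))" using x(1) X by (intro eq_vecI) auto
    have "\<exists>j<?l. x $ j \<noteq> 0"
    proof (rule ccontr)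
      assume "\<not> ?thesis"
      then have "x = 0\<^sub>v ?l" using x(1) by (intro eq_vecI) auto
      with x(2) show False ..
    qed
    then have "\<exists>v\<in>pverts G. X v \<noteq> 0" using X vs by (metis nth_mem)
    moreover have "A_apply \<alpha> G X v = \<mu> * X v" if v: "v \<in> pverts G" for v
    proof -
      obtain i where i: "i < ?l" "v = vs ! i" using v vs by (metis in_set_conv_nth)
      have "A_apply \<alpha> G X v = (?M *\<^sub>v x) $ i"
        using A_matrix_mult_vec[OF G vs i(1), of \<alpha> X] i x_eq by simp
      also have "\<dots> = \<mu> * X v" using x i X by simp
      finally show ?thesis .
    qed
    ultimately show ?R by blast
  next
    assume ?R
    then obtain X where X: "\<exists>v\<in>pverts G. X v \<noteq> 0" "\<And>v. v \<in> pverts G \<Longrightarrow> A_apply \<alpha> G X v = \<mu> * X v"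
      by blast
    let ?x = "vec ?l (\<lambda>j. X (vs ! j))"
    obtain v where "v \<in> set vs" "X v \<noteq> 0" using X(1) vs by blast
    then obtain i where i: "i < ?l" "X (vs ! i) \<noteq> 0" by (metis in_set_conv_nth)
    have "?x \<noteq> 0\<^sub>v ?l"
    proof
      assume "?x = 0\<^sub>v ?l"
      then have "?x $ i = 0\<^sub>v ?l $ i" by simp
      with i show False by simp
    qed
    moreover have "?M *\<^sub>v ?x = \<mu> \<cdot>\<^sub>v ?x"
    proof (rule eq_vecI)
      fix i assume "i < dim_vec (\<mu> \<cdot>\<^sub>v ?x)"
      then have i: "i < ?l" by simp
      then have "vs ! i \<in> pverts G" using vs by (metis nth_mem)
      then show "(?M *\<^sub>v ?x) $ i = (\<mu> \<cdot>\<^sub>v ?x) $ i"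
        using A_matrix_mult_vec[OF G vs i, of \<alpha> X] X(2) i by simp
    qed (simp only: dim dim_mult_mat_vec index_smult_vec dim_vec)
    ultimately show "eigenvalue ?M \<mu>"
      unfolding eigenvalue_def eigenvector_def dim by (intro exI[of _ ?x]) simp
  qed
qed

lemma connected_closed:
  assumes G: "pair_graph G" and con: "Digraph_Component.connected (with_proj G)"
    and Z: "Z \<subseteq> pverts G" "Z \<noteq> {}" and closed: "\<And>u v. u \<in> Z \<Longrightarrow> (u, v) \<in> parcs G \<Longrightarrow> v \<in> Z"
  shows "Z = pverts G"
proof -
  interpret pair_graph G by (rule G)
  obtain z where z: "z \<in> Z" using Z by blast
  have sc: "strongly_connected (with_proj G)"
    using symmetric_connected_imp_strongly_connected[OF sym_arcs con] .
  have "v \<in> Z" if v: "v \<in> pverts G" for v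
  proof -
    have "z \<rightarrow>\<^sup>*\<^bsub>with_proj G\<^esub> v" using sc v z Z by (auto simp: strongly_connected_def)
    then have "(z, v) \<in> (parcs G)\<^sup>*"
      by (auto simp: reachable_conv elim: rtrancl_mono[THEN subsetD, rotated])
    then show ?thesis by (induction rule: rtrancl_induct) (use z closed in auto)
  qed
  then show ?thesis using Z by blast
qed

lemma rho_eigenfunction:
  assumes G: "pair_graph G" and ne: "pverts G \<noteq> {}"
  obtains \<mu> Z where "cmod \<mu> = rho \<alpha> G" "\<exists>v\<in>pverts G. Z v \<noteq> 0" "\<And>v. v \<in> pverts G \<Longrightarrow> A_apply \<alpha> G Z v = \<mu> * Z v"
    and "\<And>\<mu> Z. \<exists>v\<in>pverts G. Z v \<noteq> 0 \<Longrightarrow> (\<And>v. v \<in> pverts G \<Longrightarrow> A_apply \<alpha> G Z v = \<mu> * Z v) \<Longrightarrow> cmod \<mu> \<le> rho \<alpha> G"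
proof -
  interpret pair_graph G by (rule G)
  obtain vs where vs: "distinct vs" "set vs = pverts G"
    using finite_distinct_list[OF pair_finite_verts] by blast
  let ?M = "map_mat complex_of_real (A_matrix \<alpha> vs G)"
  have M: "?M \<in> carrier_mat (length vs) (length vs)" using A_matrix_carrier[of \<alpha> vs G] by simp
  have l: "0 < length vs" using ne vs by auto
  have r: "rho \<alpha> G = spectral_radius ?M" using rho_eq[OF vs] .
  note sp = spectral_radius_mem_max[OF M l, folded r]
  have sp_iff: "\<mu> \<in> spectrum ?M \<longleftrightarrow>
      (\<exists>X. (\<exists>v\<in>pverts G. X v \<noteq> 0) \<and> (\<forall>v\<in>pverts G. A_apply \<alpha> G X v = \<mu> * X v))" for \<mu>
    unfolding spectrum_def mem_Collect_eq by (rule eigenvalue_A_matrix_iff[OF G vs])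
  from sp(1) obtain \<mu> where \<mu>: "\<mu> \<in> spectrum ?M" "cmod \<mu> = rho \<alpha> G" by auto
  obtain Z where Z: "\<exists>v\<in>pverts G. Z v \<noteq> 0" "\<forall>v\<in>pverts G. A_apply \<alpha> G Z v = \<mu> * Z v"
    using \<mu>(1) sp_iff by blast
  show thesis
  proof (rule that[OF \<mu>(2) Z(1)])
    fix \<mu>' :: complex and Z' assume "\<exists>v\<in>pverts G. Z' v \<noteq> 0" "\<And>v. v \<in> pverts G \<Longrightarrow> A_apply \<alpha> G Z' v = \<mu>' * Z' v"
    then have "\<mu>' \<in> spectrum ?M" using sp_iff by blast
    then show "cmod \<mu>' \<le> rho \<alpha> G" using sp(2) by blast
  qed (use Z(2) in blast)
qed

text \<open>The Collatz--Wielandt bound, proved by looking at a vertex where \<open>cmod (Z v) / X v\<close> is maximal.\<close>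

lemma
  assumes G: "pair_graph G" and ne: "pverts G \<noteq> {}" and \<alpha>: "0 \<le> \<alpha>" "\<alpha> < 1"
    and X: "\<And>v. v \<in> pverts G \<Longrightarrow> 0 < X v"
    and row: "\<And>v. v \<in> pverts G \<Longrightarrow> A_apply \<alpha> G X v \<le> r * X v"
  shows rho_le: "rho \<alpha> G \<le> r"
    and rho_eq_imp: "Digraph_Component.connected (with_proj G) \<Longrightarrow> rho \<alpha> G = r \<Longrightarrow> v \<in> pverts G \<Longrightarrow>
      A_apply \<alpha> G X v = r * X v"
proof -
  interpret pair_graph G by (rule G)
  obtain \<mu> Z where Z: "cmod \<mu> = rho \<alpha> G" "\<exists>v\<in>pverts G. Z v \<noteq> 0" "\<And>v. v \<in> pverts G \<Longrightarrow> A_apply \<alpha> G Z v = \<mu> * Z v"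
    using rho_eigenfunction[OF G ne] by metis
  define q where "q = Max ((\<lambda>v. cmod (Z v) / X v) ` pverts G)"
  have q_ge: "cmod (Z v) \<le> q * X v" if "v \<in> pverts G" for v
  proof -
    have "cmod (Z v) / X v \<le> q" using that pair_finite_verts by (simp add: q_def)
    then show ?thesis using X[OF that] by (simp add: divide_le_eq)
  qed
  have "q \<in> (\<lambda>v. cmod (Z v) / X v) ` pverts G" unfolding q_def using ne pair_finite_verts by (intro Max_in) auto
  then obtain v0 where v0: "v0 \<in> pverts G" "cmod (Z v0) = q * X v0"
    using X by (auto simp: less_imp_neq[THEN not_sym])
  have q0: "0 < q"
  proof -
    obtain u where u: "u \<in> pverts G" "Z u \<noteq> 0" using Z(2) by blast
    then have "0 < q * X u" using q_ge[OF u(1)] by (metis less_le_trans zero_less_norm_iff)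
    then show ?thesis using X[OF u(1)] by (simp add: zero_less_mult_iff)
  qed
  have terms: "\<alpha> * cmod (Z v) + (1 - \<alpha>) * cmod (Z u) \<le> q * (\<alpha> * X v + (1 - \<alpha>) * X u)"
    if "v \<in> pverts G" "u \<in> pverts G" for u v
  proof -
    have "\<alpha> * cmod (Z v) \<le> \<alpha> * (q * X v)" "(1 - \<alpha>) * cmod (Z u) \<le> (1 - \<alpha>) * (q * X u)"
      using q_ge that \<alpha> by (auto intro!: mult_left_mono)
    then show ?thesis by (simp add: algebra_simps)
  qed
  have est: "rho \<alpha> G * cmod (Z v) \<le> (\<Sum>u | (v, u) \<in> parcs G. \<alpha> * cmod (Z v) + (1 - \<alpha>) * cmod (Z u))"
    if v: "v \<in> pverts G" for v
  proof -
    have "rho \<alpha> G * cmod (Z v) = cmod (A_apply \<alpha> G Z v)" using Z(1,3) v by (simp add: norm_mult)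
    also have "\<dots> \<le> (\<Sum>u | (v, u) \<in> parcs G. \<alpha> * cmod (Z v) + (1 - \<alpha>) * cmod (Z u))"
      unfolding A_apply_def using \<alpha>
      by (intro sum_norm_le) (auto intro!: order.trans[OF norm_triangle_ineq] simp: norm_mult)
    finally show ?thesis .
  qed
  have est': "(\<Sum>u | (v, u) \<in> parcs G. q * (\<alpha> * X v + (1 - \<alpha>) * X u)) \<le> q * (r * X v)"
    if v: "v \<in> pverts G" for v
    using row[OF v] q0 by (simp add: A_apply_def flip: sum_distrib_left)
  have est2: "rho \<alpha> G * cmod (Z v) \<le> q * (r * X v)" if v: "v \<in> pverts G" for v
    using v by (intro order.trans[OF est order.trans[OF sum_mono est']] terms) (auto dest: in_arcsD2)
  have "rho \<alpha> G * (q * X v0) \<le> r * (q * X v0)" using est2[OF v0(1)] v0(2) by (simp add: mult_ac)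
  moreover have "0 < q * X v0" using q0 X v0 by simp
  ultimately show "rho \<alpha> G \<le> r" by (rule mult_right_le_imp_le)
  show "A_apply \<alpha> G X v = r * X v"
    if con: "Digraph_Component.connected (with_proj G)" and eq: "rho \<alpha> G = r" and v: "v \<in> pverts G"
  proof -
    \<comment> \<open>Vertices of maximal ratio. Equality in the estimate at one of them passes the
      maximal ratio on to its neighbours, so by connectedness \<open>C\<close> is
      everything.\<close>
    define C where "C = {v \<in> pverts G. cmod (Z v) = q * X v}"
    have tight: "cmod (Z u) = q * X u" if v: "v \<in> C" and u: "(v, u) \<in> parcs G" for u v
    proof -
      have vV: "v \<in> pverts G" and vq: "cmod (Z v) = q * X v" using v by (auto simp: C_def)
      have "(\<Sum>u | (v, u) \<in> parcs G. \<alpha> * cmod (Z v) + (1 - \<alpha>) * cmod (Z u)) =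
          (\<Sum>u | (v, u) \<in> parcs G. q * (\<alpha> * X v + (1 - \<alpha>) * X u))"
      proof (rule antisym)
        show "(\<Sum>u | (v, u) \<in> parcs G. \<alpha> * cmod (Z v) + (1 - \<alpha>) * cmod (Z u)) \<le>
            (\<Sum>u | (v, u) \<in> parcs G. q * (\<alpha> * X v + (1 - \<alpha>) * X u))"
          using terms vV by (intro sum_mono) (auto dest: in_arcsD2)
        show "(\<Sum>u | (v, u) \<in> parcs G. q * (\<alpha> * X v + (1 - \<alpha>) * X u)) \<le>
            (\<Sum>u | (v, u) \<in> parcs G. \<alpha> * cmod (Z v) + (1 - \<alpha>) * cmod (Z u))"
          using est'[OF vV] est[OF vV] eq vq by (simp add: mult_ac)
      qed
      then have "\<alpha> * cmod (Z v) + (1 - \<alpha>) * cmod (Z u) = q * (\<alpha> * X v + (1 - \<alpha>) * X u)"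
        using finite_neighbours[of v] terms vV u
        by (intro sum_mono_inv[where I="{u. (v, u) \<in> parcs G}" and f="\<lambda>u. \<alpha> * cmod (Z v) + (1 - \<alpha>) * cmod (Z u)"
              and g="\<lambda>u. q * (\<alpha> * X v + (1 - \<alpha>) * X u)"]) (auto dest: in_arcsD2)
      then have "(1 - \<alpha>) * cmod (Z u) = (1 - \<alpha>) * (q * X u)" using vq by (simp add: algebra_simps)
      then show ?thesis using \<alpha> by simp
    qed
    have "C = pverts G"
    proof (rule connected_closed[OF G con])
      show "C \<subseteq> pverts G" "C \<noteq> {}" using v0 by (auto simp: C_def)
      fix u v assume "u \<in> C" "(u, v) \<in> parcs G"
      then show "v \<in> C" using tight[of u v] in_arcsD2[of u v] by (simp add: C_def)
    qed
    then have vC: "v \<in> C" "cmod (Z v) = q * X v" using v by (auto simp: C_def)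
    have "r * (q * X v) \<le> q * A_apply \<alpha> G X v"
    proof -
      have "r * (q * X v) \<le> (\<Sum>u | (v, u) \<in> parcs G. \<alpha> * cmod (Z v) + (1 - \<alpha>) * cmod (Z u))"
        using est[OF v] eq vC by simp
      also have "\<dots> \<le> (\<Sum>u | (v, u) \<in> parcs G. q * (\<alpha> * X v + (1 - \<alpha>) * X u))"
        using terms v by (intro sum_mono) (auto dest: in_arcsD2)
      finally show ?thesis by (simp add: A_apply_def flip: sum_distrib_left)
    qed
    then have "r * X v \<le> A_apply \<alpha> G X v" using q0 by (simp add: mult.left_commute)
    then show ?thesis using row[OF v] by simp
  qed
qed

text \<open>A positive eigenfunction serves twice: as a test function for the upper bound and as an
  eigenvector for the lower one.\<close>

lemma rho_eqI:
  assumes G: "pair_graph G" and ne: "pverts G \<noteq> {}" and \<alpha>: "0 \<le> \<alpha>" "\<alpha> < 1"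
    and X: "\<And>v. v \<in> pverts G \<Longrightarrow> 0 < X v"
    and row: "\<And>v. v \<in> pverts G \<Longrightarrow> A_apply \<alpha> G X v = r * X v"
  shows "rho \<alpha> G = r"
proof (rule antisym)
  interpret pair_graph G by (rule G)
  show "rho \<alpha> G \<le> r" using row by (intro rho_le[OF G ne \<alpha> X]) auto
  define Z where "Z v = complex_of_real (X v)" for v
  have "A_apply \<alpha> G Z v = complex_of_real (A_apply \<alpha> G X v)" for v
    by (simp add: A_apply_def Z_def scaleR_conv_of_real)
  then have Z: "A_apply \<alpha> G Z v = complex_of_real r * Z v" if "v \<in> pverts G" for v
    using row[OF that] by (simp add: Z_def)
  obtain v where v: "v \<in> pverts G" using ne by blast
  then have "Z v \<noteq> 0" using X[OF v] by (simp add: Z_def)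
  then have "cmod (complex_of_real r) \<le> rho \<alpha> G"
    using rho_eigenfunction[OF G ne, of \<alpha>] Z v by metis
  then show "r \<le> rho \<alpha> G" by simp
qed

section \<open>The test function of a coloured barrier\<close>

locale coloured_barrier =
  fixes V S :: "'a set" and c :: "'a \<Rightarrow> nat" and b :: nat and \<gamma> :: real
  assumes finV: "finite V" and SV: "S \<subseteq> V" and S_ne: "S \<noteq> {}"
    and col: "c ` (V - S) = {..b * card S + 1}" and g1: "1 < \<gamma>"
begin

abbreviation n :: real where "n \<equiv> real (card V)"
abbreviation s :: real where "s \<equiv> real (card S)"
definition I :: "nat set" where "I = {..b * card S + 1}"

definition w :: real where "w = gap_root n b s \<gamma>"
text \<open>
  The function \<open>X\<close> satisfies the eigenvalue equation for \<open>bound\<close> outside \<open>S\<close> if every colour class is a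
  clique joined completely to \<open>S\<close>.
\<close>

definition bound :: real where "bound = n - 1 - w / \<gamma>"
definition big :: real where "big = n - 1 - (real b + 1) * s"
definition size :: "nat \<Rightarrow> real" where "size i = real (card {u\<in>V - S. c u = i})"
text \<open>Solving the row of a vertex outside \<open>S\<close> for its own value, with 1 on
  \<open>S\<close> and one value per class, gives
  \<open>s / (D - size i * \<gamma>)\<close>.\<close>

definition D :: real where "D = (n - s) * \<gamma> + s - w"
definition X :: "'a \<Rightarrow> real" where "X v = (if v \<in> S then 1 else s / (D - size (c v) * \<gamma>))"
text \<open>The largest loopless graph on \<open>V\<close> for which \<open>c\<close> is locally
  constant off \<open>S\<close>.\<close>

definition E :: "'a rel" where "E = {(u, v) \<in> V \<times> V. u \<noteq> v \<and> (u \<in> S \<or> v \<in> S \<or> c u = c v)}"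

lemma col_I: "c ` (V - S) = I" using col by (simp add: I_def)

lemma finite_I: "finite I" by (simp add: I_def)

lemma finS: "finite S" using SV finV finite_subset by blast

lemma s_ge: "1 \<le> s" using S_ne finS by (simp add: Suc_leI card_gt_0_iff)

lemma card_diff: "real (card (V - S)) = n - s"
  using card_Diff_subset[OF finS SV] card_mono[OF finV SV] by simp

lemma sum_size: "(\<Sum>i\<in>I. size i) = n - s"
proof -
  have "(\<Sum>i\<in>I. sum (\<lambda>_. 1 :: nat) {u\<in>V - S. c u = i}) = sum (\<lambda>_. 1) (V - S)"
    using finV finite_I col_I by (intro sum.group) auto
  then have "real (\<Sum>i\<in>I. card {u\<in>V - S. c u = i}) = real (card (V - S))" by simp
  then show ?thesis using card_diff by (simp add: size_def)
qed

lemma size_ge: "1 \<le> size i" if "i \<in> I"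
proof -
  have "i \<in> c ` (V - S)" using that col_I by simp
  then have "{u\<in>V - S. c u = i} \<noteq> {}" by auto
  moreover have "finite {u\<in>V - S. c u = i}" using finV by simp
  ultimately show ?thesis by (simp add: size_def Suc_leI card_gt_0_iff)
qed

lemma card_I: "real (card I) = b * s + 2" by (simp add: I_def)

lemma sum_size_minus_1: "(\<Sum>i\<in>I. size i - 1) = big - 1"
  using sum_size card_I by (simp add: sum_subtractf big_def algebra_simps)

lemma big_ge: "1 \<le> big"
proof -
  have "0 \<le> (\<Sum>i\<in>I. size i - 1)" using size_ge by (intro sum_nonneg) auto
  then show ?thesis using sum_size_minus_1 by simp
qed

lemma size_le: "size i \<le> big" if "i \<in> I"
proof -
  have "size i - 1 \<le> (\<Sum>i\<in>I. size i - 1)" using size_ge that finite_I by (intro member_le_sum) auto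
  then show ?thesis using sum_size_minus_1 by simp
qed

lemma adm: "admissible n b s \<gamma>"
proof -
  have "(real b + 1) * s + 2 \<le> n" using big_ge unfolding big_def by argo
  then show ?thesis unfolding admissible_def using s_ge g1 by simp
qed

lemma D_pos: "0 < D - u * \<gamma>" if "u \<le> big" for u
proof -
  have "u * \<gamma> \<le> big * \<gamma>" using that g1 by (intro mult_right_mono) auto
  moreover have "D - big * \<gamma> = (b * s + 1) * \<gamma> + s - w" by (simp add: D_def big_def algebra_simps)
  ultimately show ?thesis using gap_root(2)[OF adm] by (simp add: w_def)
qed

text \<open>This is \<open>gap = 0\<close>, read as the row of a vertex of \<open>S\<close> for the
  class sizes big, 1, ..., 1.\<close>

lemma w_eq: "s * (big / (D - big * \<gamma>) + (b * s + 1) / (D - \<gamma>)) = n - s - w"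
proof -
  have "D - big * \<gamma> = (b * s + 1) * \<gamma> + s - w" "D - \<gamma> = (n - 1 - s) * \<gamma> + s - w"
    by (simp_all add: D_def big_def algebra_simps)
  then show ?thesis using gap_root(3)[OF adm] by (simp add: gap_def w_def big_def)
qed

text \<open>The distance of the convex function \<open>u / (D - u * \<gamma>)\<close> from its chord over \<open>[1, big]\<close>.\<close>

definition excess :: "real \<Rightarrow> real" where
  "excess u = 1 / (D - \<gamma>) + (u - 1) * (D / ((D - \<gamma>) * (D - big * \<gamma>))) - u / (D - u * \<gamma>)"

text \<open>The factors make visible that the excess is nonnegative on [1, big] and vanishes only at
  the ends.\<close>

lemma excess_eq:
  assumes "u \<le> big"
  shows "excess u = (u - 1) * (big - u) * (D * \<gamma> / ((D - \<gamma>) * (D - big * \<gamma>) * (D - u * \<gamma>)))"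
proof -
  have pos: "0 < D - 1 * \<gamma>" "0 < D - u * \<gamma>" "0 < D - big * \<gamma>"
    using D_pos[of 1] D_pos[of u] D_pos[of big] big_ge assms by auto
  define P Q R where "P = D - 1 * \<gamma>" and "Q = D - u * \<gamma>" and "R = D - big * \<gamma>"
  have nz: "P \<noteq> 0" "Q \<noteq> 0" "R \<noteq> 0" using pos by (auto simp: P_def Q_def R_def)
  have QP: "D = P + \<gamma>" "Q = P + \<gamma> - u * \<gamma>" "R = P + \<gamma> - big * \<gamma>" by (simp_all add: P_def Q_def R_def)
  have "excess u = 1 / P + (u - 1) * (D / (P * R)) - u / Q" by (simp add: excess_def P_def Q_def R_def)
  also have "\<dots> = (Q * R + (u - 1) * D * Q - u * P * R) / (P * R * Q)" using nz by (simp add: field_simps)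
  also have "Q * R + (u - 1) * D * Q - u * P * R = (u - 1) * (big - u) * (D * \<gamma>)"
    unfolding QP by (simp add: algebra_simps)
  finally show ?thesis by (simp add: P_def Q_def R_def)
qed

lemma D_gt_0: "0 < D" using D_pos[of 0] big_ge by simp

lemma excess_factor_pos: "u \<le> big \<Longrightarrow> 0 < D * \<gamma> / ((D - \<gamma>) * (D - big * \<gamma>) * (D - u * \<gamma>))"
  using D_pos[of 1] D_pos[of u] D_pos[of big] big_ge g1 D_gt_0 by simp

text \<open>The chord is affine, and the number and the sum of the class sizes are fixed. So the
  chord values add up as they do for the sizes big, 1, ..., 1, and only the excesses are
  lost.\<close>

lemma sum_X: "(\<Sum>v\<in>V - S. X v) = n - s - w - s * (\<Sum>i\<in>I. excess (size i))"
proof -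
  have "(\<Sum>v\<in>V - S. X v) = (\<Sum>i\<in>I. sum X {u\<in>V - S. c u = i})"
    using finV finite_I col_I by (intro sum.group[symmetric]) auto
  also have "\<dots> = (\<Sum>i\<in>I. s * (size i / (D - size i * \<gamma>)))"
  proof (rule sum.cong)
    fix i
    have "sum X {u\<in>V - S. c u = i} = (\<Sum>u\<in>{u\<in>V - S. c u = i}. s / (D - size i * \<gamma>))"
      by (rule sum.cong) (auto simp: X_def)
    then show "sum X {u\<in>V - S. c u = i} = s * (size i / (D - size i * \<gamma>))" by (simp add: size_def)
  qed simp
  also have "\<dots> = s * (\<Sum>i\<in>I. 1 / (D - \<gamma>) + (size i - 1) * (D / ((D - \<gamma>) * (D - big * \<gamma>))) - excess (size i))"
    by (simp add: sum_distrib_left excess_def)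
  also have "\<dots> = s * ((b * s + 2) / (D - \<gamma>) + (big - 1) * (D / ((D - \<gamma>) * (D - big * \<gamma>)))) - s * (\<Sum>i\<in>I. excess (size i))"
  proof -
    have gen: "(\<Sum>i\<in>I. A + f i * K - e i) = card I * A + sum f I * K - sum e I" for A K :: real and f e
      by (simp add: sum.distrib sum_subtractf sum_distrib_right)
    show ?thesis unfolding gen card_I sum_size_minus_1 by (simp add: right_diff_distrib[of s])
  qed
  also have "(b * s + 2) / (D - \<gamma>) + (big - 1) * (D / ((D - \<gamma>) * (D - big * \<gamma>))) =
      big / (D - big * \<gamma>) + (b * s + 1) / (D - \<gamma>)"
  proof -
    have "excess big = 0" by (simp add: excess_eq)
    then show ?thesis by (simp add: excess_def add_divide_distrib)
  qed
  finally show ?thesis using w_eq by simp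
qed

lemma sum_excess_nonneg: "0 \<le> excess (size i)" if "i \<in> I"
proof -
  have "0 \<le> (size i - 1) * (big - size i)" using size_ge[OF that] size_le[OF that] by simp
  then show ?thesis
    using excess_factor_pos[OF size_le[OF that]] excess_eq[OF size_le[OF that]] by (metis less_imp_le mult_nonneg_nonneg)
qed

lemma excess_eq_0_iff: "excess (size i) = 0 \<longleftrightarrow> size i = 1 \<or> size i = big" if "i \<in> I"
proof -
  have "D * \<gamma> / ((D - \<gamma>) * (D - big * \<gamma>) * (D - size i * \<gamma>)) \<noteq> 0"
    using excess_factor_pos[OF size_le[OF that]] by (rule less_imp_neq[THEN not_sym])
  then show ?thesis unfolding excess_eq[OF size_le[OF that]] by (metis eq_iff_diff_eq_0 mult_eq_0_iff)
qed

lemma sum_X_le: "(\<Sum>v\<in>V - S. X v) \<le> n - s - w"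
  using sum_X sum_nonneg[of I "\<lambda>i. excess (size i)"] sum_excess_nonneg s_ge by simp

lemma sum_X_eq_imp:
  assumes "(\<Sum>v\<in>V - S. X v) = n - s - w"
  obtains i where "i \<in> I" "size i = big" "\<And>j. j \<in> I \<Longrightarrow> j \<noteq> i \<Longrightarrow> size j = 1"
proof -
  have "(\<Sum>i\<in>I. excess (size i)) = 0" using sum_X assms s_ge by simp
  then have "excess (size i) = 0" if "i \<in> I" for i
    using sum_excess_nonneg that finite_I by (subst (asm) sum_nonneg_eq_0_iff) auto
  then have two: "size i = 1 \<or> size i = big" if "i \<in> I" for i using excess_eq_0_iff that by blast
  show thesis
  proof (cases "\<exists>i\<in>I. size i \<noteq> 1")
    case True
    then obtain i where i: "i \<in> I" "size i = big" using two by blast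
    have "(\<Sum>j\<in>I - {i}. size j - 1) = 0"
      using sum.remove[of I i "\<lambda>j. size j - 1"] sum_size_minus_1 i finite_I by simp
    then have "size j = 1" if "j \<in> I" "j \<noteq> i" for j
      using size_ge that finite_I by (subst (asm) sum_nonneg_eq_0_iff) auto
    then show thesis using that i by blast
  next
    case False
    then have "(\<Sum>i\<in>I. size i - 1) = 0" by (intro sum.neutral) auto
    then have "big = 1" using sum_size_minus_1 by simp
    \<comment> \<open>If all classes are singletons then big = 1, and any class may be named the
      large one.\<close>
    then show thesis using that[of 0] False by (auto simp: I_def)
  qed
qed

lemma sum_X_eqI:
  assumes "\<And>i. i \<in> I \<Longrightarrow> size i = 1 \<or> size i = big"
  shows "(\<Sum>v\<in>V - S. X v) = n - s - w"
  using sum_X sum.neutral[of I "\<lambda>i. excess (size i)"] excess_eq_0_iff assms by simp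

lemma X_pos: "0 < X v" if "v \<in> V"
proof (cases "v \<in> S")
  case False
  then have "c v \<in> I" using that col_I by blast
  then show ?thesis using False D_pos[OF size_le] s_ge by (simp add: X_def)
qed (simp add: X_def)

lemma row_out:
  assumes v: "v \<in> V - S"
  shows "(\<Sum>u | (v, u) \<in> E. (1 - 1 / \<gamma>) * X v + 1 / \<gamma> * X u) = bound * X v"
proof -
  let ?C = "{u\<in>V - S. c u = c v}"
  have ci: "c v \<in> I" using v col_I by blast
  have nb: "{u. (v, u) \<in> E} = S \<union> (?C - {v})" using v SV by (auto simp: E_def)
  have finC: "finite ?C" using finV by simp
  have cardC: "real (card (?C - {v})) = size (c v) - 1"
    using v card.remove[OF finC, of v] by (simp add: size_def)
  have "(\<Sum>u\<in>S. (1 - 1 / \<gamma>) * X v + 1 / \<gamma> * X u) = s * ((1 - 1 / \<gamma>) * X v + 1 / \<gamma>)"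
    by (simp add: X_def)
  moreover have "(\<Sum>u\<in>?C - {v}. (1 - 1 / \<gamma>) * X v + 1 / \<gamma> * X u) = (size (c v) - 1) * X v"
  proof -
    have "(\<Sum>u\<in>?C - {v}. (1 - 1 / \<gamma>) * X v + 1 / \<gamma> * X u) = (\<Sum>u\<in>?C - {v}. X v)"
    proof (rule sum.cong)
      fix u assume "u \<in> ?C - {v}"
      then have "X u = X v" using v by (auto simp: X_def)
      then show "(1 - 1 / \<gamma>) * X v + 1 / \<gamma> * X u = X v" by (simp add: left_diff_distrib)
    qed simp
    then show ?thesis using cardC by simp
  qed
  ultimately have "(\<Sum>u | (v, u) \<in> E. (1 - 1 / \<gamma>) * X v + 1 / \<gamma> * X u) =
      s * ((1 - 1 / \<gamma>) * X v + 1 / \<gamma>) + (size (c v) - 1) * X v"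
    unfolding nb using finS finC by (subst sum.union_disjoint) auto
  also have "\<dots> = bound * X v"
  proof -
    have "X v * (D - size (c v) * \<gamma>) = s" using v D_pos[OF size_le[OF ci]] by (simp add: X_def)
    then have s: "s = X v * ((n - s) * \<gamma> + s - w - size (c v) * \<gamma>)" by (simp add: D_def)
    have "s * ((1 - 1 / \<gamma>) * X v + 1 / \<gamma>) = s * ((1 - 1 / \<gamma>) * X v) + s / \<gamma>" by (simp add: distrib_left)
    also have "s / \<gamma> = X v * ((n - s) * \<gamma> + s - w - size (c v) * \<gamma>) / \<gamma>" by (subst (1) s) simp
    also have "\<dots> = X v * (n - s + (s - w) / \<gamma> - size (c v))" using g1 by (simp add: field_simps)
    finally have e: "s * ((1 - 1 / \<gamma>) * X v + 1 / \<gamma>) =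
        s * ((1 - 1 / \<gamma>) * X v) + X v * (n - s + (s - w) / \<gamma> - size (c v))" .
    show ?thesis unfolding e bound_def by (simp add: algebra_simps add_divide_distrib diff_divide_distrib)
  qed
  finally show ?thesis .
qed

text \<open>By \<open>sum_X\<close>, the rows of \<open>S\<close> fall short of the eigenvalue
  equation by \<open>s / \<gamma>\<close> times the total excess.\<close>

lemma row_in:
  assumes v: "v \<in> S"
  shows "(\<Sum>u | (v, u) \<in> E. (1 - 1 / \<gamma>) * X v + 1 / \<gamma> * X u) =
    bound * X v - (n - s - w - (\<Sum>v\<in>V - S. X v)) / \<gamma>"
proof -
  have nb: "{u. (v, u) \<in> E} = (S - {v}) \<union> (V - S)" using v SV by (auto simp: E_def)
  have "(\<Sum>u\<in>S - {v}. (1 - 1 / \<gamma>) * X v + 1 / \<gamma> * X u) = (\<Sum>u\<in>S - {v}. 1)"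
    using v by (intro sum.cong) (auto simp: X_def)
  also have "\<dots> = s - 1" using v finS s_ge by (simp add: card_Diff_singleton of_nat_diff)
  finally have 1: "(\<Sum>u\<in>S - {v}. (1 - 1 / \<gamma>) * X v + 1 / \<gamma> * X u) = s - 1" .
  have "(\<Sum>u\<in>V - S. (1 - 1 / \<gamma>) * X v + 1 / \<gamma> * X u) = (n - s) * (1 - 1 / \<gamma>) + 1 / \<gamma> * (\<Sum>u\<in>V - S. X u)"
    using v card_diff by (simp add: sum.distrib sum_distrib_left X_def[of v])
  then have row: "(\<Sum>u | (v, u) \<in> E. (1 - 1 / \<gamma>) * X v + 1 / \<gamma> * X u) =
      s - 1 + ((n - s) * (1 - 1 / \<gamma>) + 1 / \<gamma> * (\<Sum>u\<in>V - S. X u))"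
    unfolding nb using finS finV 1 by (subst sum.union_disjoint) auto
  show ?thesis unfolding row using v g1 by (simp add: X_def[of v] bound_def field_simps)
qed

lemma row_le: "(\<Sum>u | (v, u) \<in> E. (1 - 1 / \<gamma>) * X v + 1 / \<gamma> * X u) \<le> bound * X v" if "v \<in> V"
  using row_out[of v] row_in[of v] sum_X_le g1 that by (cases "v \<in> S") auto

lemma finite_E: "finite {u. (v, u) \<in> E}"
  by (rule finite_subset[OF _ finV]) (auto simp: E_def)

end

text \<open>An intrinsic description of a clique \<open>S\<close> joined to a clique
  \<open>C\<close> plus isolated vertices. Three cardinalities fix it up to isomorphism, so the
  equality case can be compared with \<open>extremal_graph\<close> without its sum types.\<close>

definition clique_join :: "'a pair_pre_digraph \<Rightarrow> 'a set \<Rightarrow> 'a set \<Rightarrow> bool" where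
  "clique_join G S C \<longleftrightarrow> S \<subseteq> pverts G \<and> C \<subseteq> pverts G - S \<and>
     parcs G = {(u, v) \<in> pverts G \<times> pverts G. u \<noteq> v \<and> (u \<in> S \<or> v \<in> S \<or> u \<in> C \<and> v \<in> C)}"

lemma (in coloured_barrier) A_apply_alt:
  "pverts G = V \<Longrightarrow> A_apply (1 - 1 / \<gamma>) G X v = (\<Sum>u | (v, u) \<in> parcs G. (1 - 1 / \<gamma>) * X v + 1 / \<gamma> * X u)"
  by (simp add: A_apply_def)

text \<open>The arcs lie in \<open>E\<close> and the test function is positive, so missing arcs only
  lower the rows. If the bound is attained, all rows are tight: no arc of \<open>E\<close> is
  missing, and the rows of \<open>S\<close> leave no excess, which means one class of size big and
  singletons otherwise.\<close>

lemma (in coloured_barrier)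
  assumes G: "pair_graph G" and V: "pverts G = V" and lc: "locally_constant (V - S) (parcs G) c"
  shows rho_le_bound: "rho (1 - 1 / \<gamma>) G \<le> bound"
    and rho_eq_bound: "Digraph_Component.connected (with_proj G) \<Longrightarrow> rho (1 - 1 / \<gamma>) G = bound \<Longrightarrow>
      \<exists>C. clique_join G S C \<and> real (card C) = big"
proof -
  interpret G: pair_graph G by (rule G)
  have sub: "parcs G \<subseteq> E"
  proof
    fix e assume e: "e \<in> parcs G"
    obtain u v where uv: "e = (u, v)" by (cases e)
    with e show "e \<in> E"
      using G.in_arcsD1[of u v] G.in_arcsD2[of u v] G.no_loops'[of u v] lc V
      by (auto simp: E_def locally_constant_def)
  qed
  have ne: "pverts G \<noteq> {}" using S_ne SV V by blast
  have \<alpha>: "0 \<le> 1 - 1 / \<gamma>" "1 - 1 / \<gamma> < 1" using g1 by auto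
  have Xp: "0 < X v" if "v \<in> pverts G" for v using X_pos that V by simp
  have tpos: "0 < (1 - 1 / \<gamma>) * X v + 1 / \<gamma> * X u" if "(v, u) \<in> E" for u v
  proof -
    have "0 < X v" "0 < X u" using that X_pos by (auto simp: E_def)
    then show ?thesis using g1 \<alpha> by (intro add_nonneg_pos mult_nonneg_nonneg mult_pos_pos) auto
  qed
  have le1: "A_apply (1 - 1 / \<gamma>) G X v \<le> (\<Sum>u | (v, u) \<in> E. (1 - 1 / \<gamma>) * X v + 1 / \<gamma> * X u)" for v
    unfolding A_apply_alt[OF V] using sub finite_E tpos by (intro sum_mono2) (auto intro: less_imp_le)
  then have row: "A_apply (1 - 1 / \<gamma>) G X v \<le> bound * X v" if "v \<in> pverts G" for v
    using row_le[of v] that V order.trans by blast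
  show "rho (1 - 1 / \<gamma>) G \<le> bound" by (rule rho_le[OF G ne \<alpha> Xp row])
  show "\<exists>C. clique_join G S C \<and> real (card C) = big"
    if con: "Digraph_Component.connected (with_proj G)" and eq: "rho (1 - 1 / \<gamma>) G = bound"
  proof -
    have tight: "A_apply (1 - 1 / \<gamma>) G X v = bound * X v" if "v \<in> V" for v
      using rho_eq_imp[OF G ne \<alpha> Xp row con eq] that V by simp
    have full: "(v, u) \<in> parcs G" if vu: "(v, u) \<in> E" for v u
    proof (rule ccontr)
      assume no: "(v, u) \<notin> parcs G"
      have v: "v \<in> V" using vu by (auto simp: E_def)
      have "A_apply (1 - 1 / \<gamma>) G X v < (\<Sum>u | (v, u) \<in> E. (1 - 1 / \<gamma>) * X v + 1 / \<gamma> * X u)"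
        unfolding A_apply_alt[OF V] using sub finite_E tpos vu no
        by (intro sum_strict_mono2[where b=u]) (auto intro: less_imp_le)
      then show False using row_le[OF v] tight[OF v] by simp
    qed
    then have EG: "parcs G = E" using sub by auto
    obtain v where v: "v \<in> S" using S_ne by blast
    have "(\<Sum>u | (v, u) \<in> E. (1 - 1 / \<gamma>) * X v + 1 / \<gamma> * X u) = bound * X v"
      using tight[of v] v SV EG A_apply_alt[OF V] by auto
    then have "(\<Sum>v\<in>V - S. X v) = n - s - w" using row_in[OF v] g1 by simp
    then obtain i where i: "i \<in> I" "size i = big" "\<And>j. j \<in> I \<Longrightarrow> j \<noteq> i \<Longrightarrow> size j = 1"
      by (rule sum_X_eq_imp) blast
    define C where "C = {u\<in>V - S. c u = i}"
    have single: "u = v" if "u \<in> V - S" "v \<in> V - S" "c u = c v" "c u \<noteq> i" for u v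
    proof -
      have "c u \<in> I" using that col_I by blast
      then have "card {x\<in>V - S. c x = c u} = 1" using i(3) that by (simp add: size_def)
      then obtain y where "{x\<in>V - S. c x = c u} = {y}" by (rule card_1_singletonE)
      then show ?thesis using that by (metis (mono_tags, lifting) mem_Collect_eq singletonD)
    qed
    have "clique_join G S C"
      unfolding clique_join_def EG V
      using single SV by (auto simp: E_def C_def)
    moreover have "real (card C) = big" using i(2) by (simp add: size_def C_def)
    ultimately show ?thesis by blast
  qed
qed

lemma (in coloured_barrier) rho_eqI_bound:
  assumes G: "pair_graph G" and V: "pverts G = V" and E: "parcs G = E"
    and sizes: "\<And>i. i \<in> I \<Longrightarrow> size i = 1 \<or> size i = big"
  shows "rho (1 - 1 / \<gamma>) G = bound"
proof (rule rho_eqI[OF G])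
  show "pverts G \<noteq> {}" using S_ne SV V by blast
  show "0 \<le> 1 - 1 / \<gamma>" "1 - 1 / \<gamma> < 1" using g1 by auto
  show "0 < X v" if "v \<in> pverts G" for v using X_pos that V by simp
  show "A_apply (1 - 1 / \<gamma>) G X v = bound * X v" if "v \<in> pverts G" for v
    using row_out[of v] row_in[of v] sum_X_eqI[OF sizes] that V
    unfolding A_apply_alt[OF V] E by (cases "v \<in> S") auto
qed

section \<open>Extremal graphs\<close>

lemma digraph_iso_clique_join:
  assumes G: "pair_graph G" "clique_join G S C" and H: "pair_graph H" "clique_join H S' C'"
    and card: "card (pverts G) = card (pverts H)" "card S = card S'" "card C = card C'"
  shows "digraph_iso (with_proj G) (with_proj H)"
proof -
  interpret G: pair_graph G by (rule G)
  interpret H: pair_graph H by (rule H)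
  define R R' where "R = pverts G - (S \<union> C)" and "R' = pverts H - (S' \<union> C')"
  have SC: "S \<subseteq> pverts G" "C \<subseteq> pverts G" "S \<inter> C = {}" "S' \<subseteq> pverts H" "C' \<subseteq> pverts H" "S' \<inter> C' = {}"
    using G(2) H(2) by (auto simp: clique_join_def)
  have fin: "finite S" "finite C" "finite S'" "finite C'"
    using SC G.pair_finite_verts H.pair_finite_verts finite_subset by blast+
  have "card R = card R'"
    using SC fin card by (simp add: R_def R'_def card_Diff_subset card_Un_disjoint)
  then obtain f1 f2 f3 where f: "bij_betw f1 S S'" "bij_betw f2 C C'" "bij_betw f3 R R'"
    using finite_same_card_bij[OF fin(1,3) card(2)] finite_same_card_bij[OF fin(2,4) card(3)]
      finite_same_card_bij[of R R'] G.pair_finite_verts H.pair_finite_verts by (auto simp: R_def R'_def)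
  define f where "f v = (if v \<in> S then f1 v else if v \<in> C then f2 v else f3 v)" for v
  have fS: "bij_betw f S S'" using f(1) by (simp add: f_def cong: bij_betw_cong)
  have fC: "bij_betw f C C'" using f(2) SC(3) by (subst bij_betw_cong[of C f f2]) (auto simp: f_def)
  have fR: "bij_betw f R R'" using f(3) by (subst bij_betw_cong[of R f f3]) (auto simp: f_def R_def)
  have "bij_betw f (S \<union> C \<union> R) (S' \<union> C' \<union> R')"
    using fS fC fR SC by (intro bij_betw_combine) (auto simp: R'_def)
  moreover have "S \<union> C \<union> R = pverts G" "S' \<union> C' \<union> R' = pverts H" using SC by (auto simp: R_def R'_def)
  ultimately have bij: "bij_betw f (pverts G) (pverts H)" by simp
  have inj: "inj_on f (pverts G)" and img: "f ` pverts G = pverts H" using bij by (auto simp: bij_betw_def)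
  have memS: "f v \<in> S' \<longleftrightarrow> v \<in> S" and memC: "f v \<in> C' \<longleftrightarrow> v \<in> C" if "v \<in> pverts G" for v
    using that fS fC SC inj by (auto simp: bij_betw_def dest: inj_onD)
  have arcs: "parcs H = map_prod f f ` parcs G"
  proof (intro subset_antisym subsetI)
    fix e assume e: "e \<in> parcs H"
    obtain x y where xy: "e = (x, y)" by (cases e)
    then have "x \<in> f ` pverts G" "y \<in> f ` pverts G" using e img H.in_arcsD1 H.in_arcsD2 by auto
    then obtain u v where uv: "u \<in> pverts G" "v \<in> pverts G" "x = f u" "y = f v" by blast
    then have "(u, v) \<in> parcs G"
      using e xy G(2) H(2) memS memC by (auto simp: clique_join_def)
    then show "e \<in> map_prod f f ` parcs G" using xy uv by force
  next
    fix e assume "e \<in> map_prod f f ` parcs G"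
    then obtain u v where uv: "(u, v) \<in> parcs G" "e = (f u, f v)" by auto
    then have "u \<in> pverts G" "v \<in> pverts G" "u \<noteq> v" using G.in_arcsD1 G.in_arcsD2 G.no_loops' by blast+
    moreover from this have "f u \<noteq> f v" "f u \<in> pverts H" "f v \<in> pverts H" using inj img by (auto dest: inj_onD)
    ultimately show "e \<in> parcs H"
      using uv G(2) H(2) memS memC by (auto simp: clique_join_def)
  qed
  define hom where "hom = \<lparr>iso_verts = f, iso_arcs = map_prod f f, iso_head = snd, iso_tail = (fst :: 'b \<times> 'b \<Rightarrow> 'b)\<rparr>"
  have "inj_on (map_prod f f) (parcs G)"
    using inj G.in_arcsD1 G.in_arcsD2 by (auto simp: inj_on_def)
  then have "pre_digraph.digraph_isomorphism (with_proj G) hom"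
    using inj G.wf_digraph_axioms by (auto simp: pre_digraph.digraph_isomorphism_def hom_def)
  moreover have "with_proj H = app_iso hom (with_proj G)"
    using arcs img by (simp add: app_iso_def hom_def with_proj_def)
  ultimately show ?thesis unfolding digraph_iso_def by blast
qed

lemma
  assumes s: "1 \<le> s" "(b + 1) * s + 2 \<le> n" and g: "1 < \<gamma>"
  shows rho_extremal_graph: "rho (1 - 1 / \<gamma>) (extremal_graph n b s) = real n - 1 - gap_root n b s \<gamma> / \<gamma>"
    and clique_join_extremal_graph: "\<exists>S C. clique_join (extremal_graph n b s) S C \<and> card S = s \<and>
      card C = n - (b + 1) * s - 1"
proof -
  let ?G = "extremal_graph n b s"
  define m where "m = n - (b + 1) * s - 1"
  have m: "0 < m" using s by (simp add: m_def)
  \<comment> \<open>The union with the empty set only fixes the vertex type.\<close>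
  define S where "S = Inl ` {..<s} \<union> ({} :: (nat + nat + nat) set)"
  \<comment> \<open>Colour 0 is the clique and \<open>Suc i\<close> the isolated vertex i; the value
    on \<open>S\<close> is a dummy.\<close>
  define c :: "nat + nat + nat \<Rightarrow> nat" where
    "c = case_sum (\<lambda>_. 0) (case_sum (\<lambda>_. 0) Suc)"
  have V: "pverts ?G = S \<union> (\<lambda>i. Inr (Inl i)) ` {..<m} \<union> (\<lambda>i. Inr (Inr i)) ` {..<b * s + 1}"
    by (auto simp: extremal_graph_def graph_join_def disjoint_union_def complete_graph_def
        isolated_vertices_def S_def m_def Plus_def)
  have VS: "pverts ?G - S = (\<lambda>i. Inr (Inl i)) ` {..<m} \<union> (\<lambda>i. Inr (Inr i)) ` {..<b * s + 1}"
    unfolding V by (auto simp: S_def)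
  have cS: "card S = s" by (simp add: S_def card_image)
  have nV: "card (pverts ?G) = n" using s by (intro card_extremal_graph) simp
  have cVS: "c ` (pverts ?G - S) = {..b * s + 1}"
  proof -
    have "c ` (pverts ?G - S) = (\<lambda>_. 0) ` {..<m} \<union> Suc ` {..<b * s + 1}"
      unfolding VS by (simp add: image_Un image_image c_def)
    also have "(\<lambda>_. 0 :: nat) ` {..<m} = {0}" using m by auto
    also have "{0} \<union> Suc ` {..<b * s + 1} = {..b * s + 1}"
      using lessThan_Suc_eq_insert_0[of "b * s + 1"] by (simp add: lessThan_Suc_atMost)
    finally show ?thesis .
  qed
  interpret G: pair_graph ?G by (rule pair_graph_extremal_graph)
  interpret B: coloured_barrier "pverts ?G" S c b \<gamma>
  proof
    show "finite (pverts ?G)" by (rule G.pair_finite_verts)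
    show "S \<subseteq> pverts ?G" unfolding V by blast
    show "S \<noteq> {}" using cS s by auto
    show "c ` (pverts ?G - S) = {..b * card S + 1}" using cVS cS by simp
  qed (rule g)
  have cls0: "{u \<in> pverts ?G - S. c u = 0} = (\<lambda>i. Inr (Inl i)) ` {..<m}"
    unfolding VS by (auto simp: c_def)
  have clsS: "{u \<in> pverts ?G - S. c u = Suc i} = {Inr (Inr i)}" if "i < b * s + 1" for i
    unfolding VS using that by (auto simp: c_def)
  have big: "B.big = m" using s by (simp add: B.big_def nV cS m_def of_nat_diff algebra_simps)
  have sz: "B.size i = 1 \<or> B.size i = B.big" if "i \<in> B.I" for i
  proof (cases i)
    case 0
    then show ?thesis using big cls0 by (simp add: B.size_def card_image inj_on_def)
  next
    case (Suc j)
    then have "j < b * s + 1" using that cS by (simp add: B.I_def)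
    then show ?thesis using clsS Suc by (simp add: B.size_def)
  qed
  have arcs: "parcs ?G = B.E"
    unfolding B.E_def
    by (auto simp: extremal_graph_def graph_join_def disjoint_union_def complete_graph_def
        isolated_vertices_def S_def c_def)
  show "rho (1 - 1 / \<gamma>) ?G = real n - 1 - gap_root n b s \<gamma> / \<gamma>"
    using B.rho_eqI_bound[OF pair_graph_extremal_graph refl arcs sz] by (simp add: B.bound_def B.w_def nV cS)
  have "clique_join ?G S ((\<lambda>i. Inr (Inl i)) ` {..<m})"
    unfolding clique_join_def
  proof (intro conjI)
    show "S \<subseteq> pverts ?G" unfolding V by blast
    show "(\<lambda>i. Inr (Inl i)) ` {..<m} \<subseteq> pverts ?G - S" unfolding VS by blast
    have "c u = c v \<longleftrightarrow> u \<in> (\<lambda>i. Inr (Inl i)) ` {..<m} \<and> v \<in> (\<lambda>i. Inr (Inl i)) ` {..<m}"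
      if "u \<in> pverts ?G - S" "v \<in> pverts ?G - S" "u \<noteq> v" for u v
      using that unfolding VS by (auto simp: c_def)
    moreover have "S \<inter> (\<lambda>i. Inr (Inl i)) ` {..<m} = {}" by (auto simp: S_def)
    ultimately show "parcs ?G = {(u, v) \<in> pverts ?G \<times> pverts ?G. u \<noteq> v \<and>
        (u \<in> S \<or> v \<in> S \<or> u \<in> (\<lambda>i. Inr (Inl i)) ` {..<m} \<and> v \<in> (\<lambda>i. Inr (Inl i)) ` {..<m})}"
      unfolding arcs B.E_def by blast
  qed
  moreover have "card ((\<lambda>i. Inr (Inl i) :: nat + nat + nat) ` {..<m}) = m" by (simp add: card_image inj_on_def)
  ultimately show "\<exists>S C. clique_join ?G S C \<and> card S = s \<and> card C = n - (b + 1) * s - 1"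
    using cS m_def by metis
qed

text \<open>Without \<open>S\<close> the two colours 0 and 1 would occur, and the class of 0 would
  be closed under adjacency in a connected graph.\<close>

lemma barrier_nonempty:
  assumes G: "pair_graph G" and con: "Digraph_Component.connected (with_proj G)"
    and c: "locally_constant (pverts G - S) (parcs G) c" "c ` (pverts G - S) = {..b * card S + (1 :: nat)}"
  shows "S \<noteq> {}"
proof
  assume S: "S = {}"
  interpret pair_graph G by (rule G)
  have img: "c ` pverts G = {..1}" using c(2) S by simp
  have "0 \<in> c ` pverts G" "1 \<in> c ` pverts G" unfolding img by auto
  then obtain u v where uv: "u \<in> pverts G" "c u = 0" "v \<in> pverts G" "c v = 1" by force
  have "{x \<in> pverts G. c x = 0} = pverts G"
  proof (rule connected_closed[OF G con])
    fix x y assume "x \<in> {x \<in> pverts G. c x = 0}" "(x, y) \<in> parcs G"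
    then show "y \<in> {x \<in> pverts G. c x = 0}"
      using c(1) S in_arcsD2[of x y] by (auto simp: locally_constant_def)
  qed (use uv in auto)
  then have "c v = 0" using uv(3) by blast
  then show False using uv(4) by simp
qed

text \<open>The common core of the three cases: as \<open>w\<close> is the smaller root, the last
  hypothesis says that the radius of \<open>G\<close> is at least the larger of the two extremal
  ones.\<close>

theorem rho_extremal:
  assumes b: "3 \<le> b" "odd b" and G: "pair_graph G" "Digraph_Component.connected (with_proj G)"
    and n: "card (pverts G) = n" "even n" and cross: "crossing n b k m c" and k: "k = real (k_max n b)"
    and no: "\<nexists>H. odd_factor b G H" and g: "2 < \<gamma>"
    and w: "w = min (gap_root n b 1 \<gamma>) (gap_root n b k \<gamma>)"
    and rho: "real n - 1 - w / \<gamma> \<le> rho (1 - 1 / \<gamma>) G"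
  shows "gap_root n b 1 \<gamma> = w \<and> digraph_iso (with_proj G) (with_proj (extremal_graph n b 1)) \<or>
    gap_root n b k \<gamma> = w \<and> digraph_iso (with_proj G) (with_proj (extremal_graph n b (k_max n b)))"
proof -
  interpret G: pair_graph G by (rule G)
  interpret crossing n b k m c by (rule cross)
  have "even (card (pverts G))" using n by simp
  from odd_factor_or_barrier[OF G(1) b(2) this no]
  obtain S and c :: "'a \<Rightarrow> nat" where S: "S \<subseteq> pverts G" "locally_constant (pverts G - S) (parcs G) c"
      "c ` (pverts G - S) = {..b * card S + 1}" by blast
  interpret B: coloured_barrier "pverts G" S c b \<gamma>
    using barrier_nonempty[OF G S(2,3)] S g G.pair_finite_verts by unfold_locales auto
  define s where "s = card S"
  have s1: "1 \<le> s" using B.s_ge by (simp add: s_def)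
  have adms: "admissible n b s \<gamma>" using B.adm n by (simp add: s_def)
  then have "(real b + 1) * real s + 2 \<le> real n" by (simp add: admissible_def)
  then have sn: "(b + 1) * s + 2 \<le> n" by (metis (mono_tags) of_nat_1 of_nat_add of_nat_le_iff of_nat_mult of_nat_numeral)
  then have sk: "s \<le> k_max n b" unfolding k_max_def by (simp add: less_eq_div_iff_mult_less_eq mult.commute)
  have bound: "B.bound = real n - 1 - gap_root n b s \<gamma> / \<gamma>" by (simp add: B.bound_def B.w_def n s_def)
  have le: "gap_root n b s \<gamma> \<le> w"
  proof -
    have "real n - 1 - w / \<gamma> \<le> real n - 1 - gap_root n b s \<gamma> / \<gamma>"
      using rho B.rho_le_bound[OF G(1) refl S(2)] bound by simp
    then show ?thesis using g by (simp add: divide_le_cancel)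
  qed
  \<comment> \<open>An interior barrier size would have a root above \<open>w\<close>, contradicting
    \<open>le\<close>.\<close>
  have "s = 1 \<or> s = k_max n b"
  proof (rule ccontr)
    assume "\<not> ?thesis"
    then have "1 < real s" "real s < k" using s1 sk k by auto
    moreover have "b + 2 \<le> \<gamma> \<or> \<gamma> < w" using gamma_less_gap_roots[OF g] w by linarith
    ultimately have "w < gap_root n b s \<gamma>" using g w by (intro gap_root_interior[OF adm]) auto
    with le show False by simp
  qed
  then have gr: "gap_root n b s \<gamma> = w" using le w k by (auto simp: min_def)
  then have "rho (1 - 1 / \<gamma>) G = B.bound"
    using rho B.rho_le_bound[OF G(1) refl S(2)] bound by simp
  then obtain C where C: "clique_join G S C" "real (card C) = B.big"
    using B.rho_eq_bound[OF G(1) refl S(2) G(2)] by blast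
  have "real (card C) = real (n - (b + 1) * s - 1)"
    using C(2) sn by (simp add: B.big_def n s_def of_nat_diff algebra_simps)
  then have cC: "card C = n - (b + 1) * s - 1" by simp
  obtain S' C' where C': "clique_join (extremal_graph n b s) S' C'" "card S' = s" "card C' = n - (b + 1) * s - 1"
    using clique_join_extremal_graph[OF s1 sn] g by (metis less_trans one_less_numeral_iff semiring_norm(76))
  have "digraph_iso (with_proj G) (with_proj (extremal_graph n b s))"
    using C C' cC n sn card_extremal_graph[of b s n]
    by (intro digraph_iso_clique_join[OF G(1) C(1) pair_graph_extremal_graph C'(1)]) (auto simp: s_def)
  then show ?thesis using \<open>s = 1 \<or> s = k_max n b\<close> gr k by auto
qed

text \<open>The clique order in the last extremal graph is \<open>(n - 2) mod (b + 1) + 1\<close>,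
  hence between 1 and b + 1.\<close>

lemma crossing_k_max:
  assumes b: "3 \<le> b" and n: "order_bound b \<le> n"
  shows "crossing n b (k_max n b) (real n - 1 - (b + 1) * k_max n b) (b * k_max n b)"
    and "14 \<le> k_max n b" "(b + 1) * k_max n b + 2 \<le> n"
proof -
  let ?k = "k_max n b"
  have "(b + 1) * 14 \<le> (b + 1) * max (2 * b + 3) 14" by (intro mult_left_mono) auto
  then have n2: "(b + 1) * 14 \<le> n - 2" and n_ge: "2 \<le> n" using n by (auto simp: order_bound_def)
  show k14: "14 \<le> ?k" unfolding k_max_def using n2 by (simp add: less_eq_div_iff_mult_less_eq mult.commute)
  have "(b + 1) * ?k \<le> n - 2" "n - 2 < (b + 1) * ?k + (b + 1)"
    unfolding k_max_def using mult_div_mod_eq[of "b + 1" "n - 2"] mod_less_divisor[of "b + 1" "n - 2"]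
    by linarith+
  then have le: "(b + 1) * ?k + 2 \<le> n" "n < (b + 1) * ?k + b + 3" using n_ge by linarith+
  then show "(b + 1) * ?k + 2 \<le> n" by simp
  have "real ((b + 1) * ?k + 2) \<le> real n" "real (n + 1) \<le> real ((b + 1) * ?k + b + 3)"
    using le by (intro of_nat_mono; simp)+
  then show "crossing n b ?k (real n - 1 - (b + 1) * ?k) (b * ?k)"
    using b k14 by unfold_locales (simp_all add: algebra_simps)
qed

text \<open>The map \<gamma> = 1 / (1 - \<alpha>) sends (1/2, 1) increasingly onto the numbers above
  2, and equal radii mean equal roots. So the single crossing makes the definite description in
  \<open>alpha_star\<close> proper.\<close>

theorem alpha_star_crossing:
  assumes "crossing n b (k_max n b) m c" and k: "1 \<le> k_max n b" "(b + 1) * k_max n b + 2 \<le> n"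
  obtains g where "2 < g" "alpha_star n b = 1 - 1 / g" "gap_root n b 1 g = gap_root n b (k_max n b) g"
    "\<And>\<gamma>. 2 < \<gamma> \<Longrightarrow> \<gamma> < g \<Longrightarrow> gap_root n b 1 \<gamma> < gap_root n b (k_max n b) \<gamma>"
    "\<And>\<gamma>. g < \<gamma> \<Longrightarrow> gap_root n b (k_max n b) \<gamma> < gap_root n b 1 \<gamma>"
proof -
  interpret crossing n b "k_max n b" m c by (rule assms)
  obtain g where g: "2 < g" "gap_root n b 1 g = gap_root n b (k_max n b) g"
    "\<And>\<gamma>. 2 < \<gamma> \<Longrightarrow> \<gamma> < g \<Longrightarrow> gap_root n b 1 \<gamma> < gap_root n b (k_max n b) \<gamma>"
    "\<And>\<gamma>. g < \<gamma> \<Longrightarrow> gap_root n b (k_max n b) \<gamma> < gap_root n b 1 \<gamma>"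
    by (rule crossing_point) blast
  have "(b + 1) * 1 \<le> (b + 1) * k_max n b" using k by (intro mult_left_mono) auto
  then have b1: "(b + 1) * 1 + 2 \<le> n" using k by linarith
  have rho_eq: "rho (1 - 1 / \<gamma>) (extremal_graph n b 1) = rho (1 - 1 / \<gamma>) (extremal_graph n b (k_max n b)) \<longleftrightarrow>
      gap_root n b 1 \<gamma> = gap_root n b (k_max n b) \<gamma>" if "1 < \<gamma>" for \<gamma>
    using rho_extremal_graph[OF _ b1 that] rho_extremal_graph[OF k that] that by simp
  have "alpha_star n b = 1 - 1 / g"
    unfolding alpha_star_def
  proof (rule the_equality)
    show "1 / 2 < 1 - 1 / g \<and> 1 - 1 / g < 1 \<and>
        rho (1 - 1 / g) (extremal_graph n b 1) = rho (1 - 1 / g) (extremal_graph n b (k_max n b))"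
      using g rho_eq[of g] by (simp add: field_simps)
    fix \<alpha> assume \<alpha>: "1 / 2 < \<alpha> \<and> \<alpha> < 1 \<and>
        rho \<alpha> (extremal_graph n b 1) = rho \<alpha> (extremal_graph n b (k_max n b))"
    define \<gamma> where "\<gamma> = 1 / (1 - \<alpha>)"
    have \<gamma>: "2 < \<gamma>" "\<alpha> = 1 - 1 / \<gamma>" using \<alpha> by (auto simp: \<gamma>_def field_simps)
    then have "gap_root n b 1 \<gamma> = gap_root n b (k_max n b) \<gamma>" using \<alpha> rho_eq[of \<gamma>] by simp
    then have "\<gamma> = g" using g(3)[OF \<gamma>(1)] g(4)[of \<gamma>] by (cases \<gamma> g rule: linorder_cases) auto
    then show "\<alpha> = 1 - 1 / g" using \<gamma> by simp
  qed
  then show thesis using that g by blast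
qed

theorem theorem1p3:
  fixes b n k :: nat and \<alpha> :: real and G :: "'a pair_pre_digraph"
  assumes "3 \<le> b" and "odd b"
    and "pair_graph G" and "Digraph_Component.connected (with_proj G)"
    and "card (pverts G) = n" and "even n" and "order_bound b \<le> n"
    and "k = k_max n b"
  shows
    "(1 / 2 < \<alpha> \<and> \<alpha> < alpha_star n b \<and> rho \<alpha> G \<ge> rho \<alpha> (extremal_graph n b 1) \<longrightarrow>
        (\<exists>H. odd_factor b G H) \<or>
        digraph_iso (with_proj G) (with_proj (extremal_graph n b 1))) \<and>
     (alpha_star n b < \<alpha> \<and> \<alpha> < 1 \<and> rho \<alpha> G \<ge> rho \<alpha> (extremal_graph n b k) \<longrightarrow>
        (\<exists>H. odd_factor b G H) \<or>
        digraph_iso (with_proj G) (with_proj (extremal_graph n b k))) \<and>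
     (\<alpha> = alpha_star n b \<and> rho \<alpha> G \<ge> rho \<alpha> (extremal_graph n b 1) \<longrightarrow>
        (\<exists>H. odd_factor b G H) \<or>
        digraph_iso (with_proj G) (with_proj (extremal_graph n b 1)) \<or>
        digraph_iso (with_proj G) (with_proj (extremal_graph n b k)))"
proof -
  define m where "m = real n - 1 - (b + 1) * k_max n b"
  have cross: "crossing n b (k_max n b) m (b * k_max n b)" and k: "14 \<le> k_max n b" "(b + 1) * k_max n b + 2 \<le> n"
    unfolding m_def using crossing_k_max[OF assms(1,7)] by simp_all
  have k1: "1 \<le> k_max n b" using k by simp
  have "(b + 1) * 1 \<le> (b + 1) * k_max n b" using k1 by (intro mult_left_mono) auto
  then have b1: "(b + 1) * 1 + 2 \<le> n" using k by linarith
  obtain g where g: "2 < g" "alpha_star n b = 1 - 1 / g" "gap_root n b 1 g = gap_root n b (k_max n b) g"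
      "\<And>\<gamma>. 2 < \<gamma> \<Longrightarrow> \<gamma> < g \<Longrightarrow> gap_root n b 1 \<gamma> < gap_root n b (k_max n b) \<gamma>"
      "\<And>\<gamma>. g < \<gamma> \<Longrightarrow> gap_root n b (k_max n b) \<gamma> < gap_root n b 1 \<gamma>"
    by (rule alpha_star_crossing[OF cross k1 k(2)]) blast
  have half: "1 / 2 < alpha_star n b" "alpha_star n b < 1" unfolding g(2) using g(1) by (auto simp: field_simps)
  \<comment> \<open>The minimum is the root for s = 1 before the crossing, the root for s = k after
    it, and both at the crossing; each case only discards alternatives.\<close>
  have main: "(\<exists>H. odd_factor b G H) \<or>
      gap_root n b 1 \<gamma> = min (gap_root n b 1 \<gamma>) (gap_root n b k \<gamma>) \<and>
        digraph_iso (with_proj G) (with_proj (extremal_graph n b 1)) \<or>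
      gap_root n b k \<gamma> = min (gap_root n b 1 \<gamma>) (gap_root n b k \<gamma>) \<and>
        digraph_iso (with_proj G) (with_proj (extremal_graph n b k))"
    if "2 < \<gamma>" "real n - 1 - min (gap_root n b 1 \<gamma>) (gap_root n b k \<gamma>) / \<gamma> \<le> rho (1 - 1 / \<gamma>) G" for \<gamma>
    using rho_extremal[OF assms(1-6) cross refl _ that(1) refl] that(2) assms(8) by blast
  have param: "\<exists>\<gamma>>2. \<alpha> = 1 - 1 / \<gamma>" if "1 / 2 < \<alpha>" "\<alpha> < 1"
    using that by (intro exI[of _ "1 / (1 - \<alpha>)"]) (auto simp: field_simps)
  have order: "1 - 1 / \<gamma> < 1 - 1 / g \<longleftrightarrow> \<gamma> < g" "1 - 1 / g < 1 - 1 / \<gamma> \<longleftrightarrow> g < \<gamma>" if "2 < \<gamma>" for \<gamma>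
    using that g(1) by (auto simp: field_simps)
  have rho1: "rho (1 - 1 / \<gamma>) (extremal_graph n b 1) = real n - 1 - gap_root n b 1 \<gamma> / \<gamma>"
    and rhok: "rho (1 - 1 / \<gamma>) (extremal_graph n b k) = real n - 1 - gap_root n b k \<gamma> / \<gamma>" if "2 < \<gamma>" for \<gamma>
    using rho_extremal_graph[OF _ b1, of \<gamma>] rho_extremal_graph[OF k1 k(2), of \<gamma>] that assms(8) by simp_all
  show ?thesis
  proof (intro conjI impI; elim conjE)
    assume \<alpha>: "1 / 2 < \<alpha>" "\<alpha> < alpha_star n b" and rho: "rho \<alpha> (extremal_graph n b 1) \<le> rho \<alpha> G"
    have "\<alpha> < 1" using \<alpha>(2) half(2) by simp
    then obtain \<gamma> where \<gamma>: "2 < \<gamma>" "\<alpha> = 1 - 1 / \<gamma>" using param[OF \<alpha>(1)] by blast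
    have less: "\<gamma> < g" using \<alpha>(2) g(2) \<gamma>(2) order(1)[OF \<gamma>(1)] by simp
    show "(\<exists>H. odd_factor b G H) \<or> digraph_iso (with_proj G) (with_proj (extremal_graph n b 1))"
      using main[OF \<gamma>(1)] rho rho1[OF \<gamma>(1)] g(4)[OF \<gamma>(1) less] assms(8) \<gamma>(2) by (simp add: min_def)
  next
    assume \<alpha>: "alpha_star n b < \<alpha>" "\<alpha> < 1" and rho: "rho \<alpha> (extremal_graph n b k) \<le> rho \<alpha> G"
    have "1 / 2 < \<alpha>" using \<alpha>(1) half(1) by simp
    then obtain \<gamma> where \<gamma>: "2 < \<gamma>" "\<alpha> = 1 - 1 / \<gamma>" using param[OF _ \<alpha>(2)] by blast
    have less: "g < \<gamma>" using \<alpha>(1) g(2) \<gamma>(2) order(2)[OF \<gamma>(1)] by simp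
    show "(\<exists>H. odd_factor b G H) \<or> digraph_iso (with_proj G) (with_proj (extremal_graph n b k))"
      using main[OF \<gamma>(1)] rho rhok[OF \<gamma>(1)] g(5)[OF less] assms(8) \<gamma>(2) by (simp add: min_def)
  next
    assume \<alpha>: "\<alpha> = alpha_star n b" and rho: "rho \<alpha> (extremal_graph n b 1) \<le> rho \<alpha> G"
    show "(\<exists>H. odd_factor b G H) \<or> digraph_iso (with_proj G) (with_proj (extremal_graph n b 1)) \<or>
        digraph_iso (with_proj G) (with_proj (extremal_graph n b k))"
      using main[OF g(1)] rho rho1[OF g(1)] g(3) assms(8) unfolding \<alpha> g(2) by auto
  qed
qed

end
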